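(* Let $t_1>0$ and consider the coupled control system $\dot y(t)=A_Yy(t)+A_{YZ}z(t)+b_Yu(t)$, $\dot z(t)=A_Zz(t)+b_Zu(t)$ on $X=Y\times Z$ with scalar control $u$, under the standing assumptions listed in the context, in the case $\sigma_Y\cap\sigma_Z=\varnothing$. For $j\in I_Y$ and $t\in[0,t_1]$ put $$b_j(t)=b_j-e^{\lambda_jt}e^{-\lambda_jt_1}\left(S_Z(t_1-t)b_Z,\psi_{Zj}\right),\qquad b_j=(b,\psi_j).$$ Assume that the series $$\sum_{j\in I_Y}\left|e^{-\lambda_jt_1}\right|^{2}\left|\left(S_Z(t_1)x_Z^0,\psi_{Zj}\right)\right|^2$$ converges for every $x_Z^0\in Z$. Then the system is partially null-controllable on $[0,t_1]$ if and only if the family of functions $\{e^{-\lambda_jt}b_j(t),\ t\in[0,t_1]\}_{j\in I_Y}$ is strongly minimal in $L_2[0,t_1]$.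
   Context: Setting. $Y,Z$ are separable complex Hilbert spaces with inner products $(\cdot,\cdot)$ linear in the first argument, and $X=Y\times Z$. $A_Y$ and $A_Z$ generate strongly continuous semigroups $S_Y(t)$ on $Y$ and $S_Z(t)$ on $Z$; $A_{YZ}:Z\to Y$ is a bounded linear operator; $A=\begin{pmatrix}A_Y&A_{YZ}\\0&A_Z\end{pmatrix}$ (domain $D(A_Y)\times D(A_Z)$) generates the strongly continuous semigroup $S(t)$ on $X$; $b=(b_Y,b_Z)\in X$. The coupled system is $\dot x=Ax+bu$ with $x=(y,z)$, $x(0)=x^0=(x^0_Y,x^0_Z)$, and mild solution $x(t)=S(t)x^0+\int_0^tS(t-\tau)bu(\tau)\,d\tau$. Standing assumptions. $A$ has purely point spectrum $\sigma_A$, which is finite or has no finite limit points, each eigenvalue having finite multiplicity; the generalized eigenvectors of $A$ form a Riesz basis of $X$; the eigenvalues of $A_Y$ and of $A_Z$ are simple. $\sigma_Y,\sigma_Z$ are the spectra of $A_Y,A_Z$; $\sigma_A=\sigma_Y\cup\sigma_Z=\{\lambda_i\}$ is an enumeration of the distinct eigenvalues; $I_Y=\{i:\lambda_i\in\sigma_Y\}$, $I_Z=\{i:\lambda_i\in\sigma_Z\}$; here $\sigma_Y\cap\sigma_Z=\varnothing$. Eigenvectors. For $j\in I_Y$: $\varphi_j=(\varphi_{Yj},0)$ with $A_Y\varphi_{Yj}=\lambda_j\varphi_{Yj}$, and $\psi_j=(\psi_{Yj},\psi_{Zj})$ with $A_Y^*\psi_{Yj}=\bar\lambda_j\psi_{Yj}$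 and $A_{YZ}^*\psi_{Yj}+A_Z^*\psi_{Zj}=\bar\lambda_j\psi_{Zj}$. For $k\in I_Z$: $\varphi_k=(\varphi_{Yk},\varphi_{Zk})$ with $A_Z\varphi_{Zk}=\lambda_k\varphi_{Zk}$ and $A_Y\varphi_{Yk}+A_{YZ}\varphi_{Zk}=\lambda_k\varphi_{Yk}$, and $\psi_k=(0,\psi_{Zk})$ with $A_Z^*\psi_{Zk}=\bar\lambda_k\psi_{Zk}$. These are eigenvectors of $A$ (for $\lambda_i$) and of $A^*$ (for $\bar\lambda_i$), chosen so that $\{\varphi_i\}$ and $\{\psi_i\}$ are Riesz bases of $X$ and $(\varphi_m,\psi_n)=\delta_{mn}$. Partial null-controllability on $[0,t_1]$: for each $x^0\in X$ there is a scalar control $u\in L_2[0,t_1]$ such that the $Y$-component of $x(t_1)$ is zero, i.e. $Px(t_1)=0$ with $P(y,z)=(y,0)$. Strong minimality: a sequence $x_1,x_2,\dots$ in a Hilbert space is strongly minimal if, with $\lambda_1^n$ the smallest eigenvalue of the Gram matrix $((x_i,x_j))_{i,j=1}^n$, one has $\lim_{n\to\infty}\lambda_1^n>0$ (for a finite family: the smallest eigenvalue of its Gram matrix is positive). *)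

theory Defs
  imports
    "Jordan_Normal_Form.Spectral_Radius"
    "HOL-Analysis.Analysis"
    "HOL-Library.Infinite_Set"
begin

section \<open>Complex Hilbert spaces\<close>

text \<open>
  Complex inner product spaces are set up on top of \<open>real_inner\<close>, so that the norm, the topology,
  limits and the Bochner integral are the library's. The complex inner product is linear in its
  first argument; its real part is the underlying real inner product.
\<close>

class complex_inner = real_inner +
  fixes scaleC :: "complex \<Rightarrow> 'a \<Rightarrow> 'a"  (infixr \<open>*\<^sub>C\<close> 75)
    and cinner :: "'a \<Rightarrow> 'a \<Rightarrow> complex"
  assumes scaleC_add_right: "a *\<^sub>C (x + y) = a *\<^sub>C x + a *\<^sub>C y"
    and scaleC_add_left: "(a + b) *\<^sub>C x = a *\<^sub>C x + b *\<^sub>C x"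
    and scaleC_scaleC: "a *\<^sub>C b *\<^sub>C x = (a * b) *\<^sub>C x"
    and scaleC_of_real: "complex_of_real r *\<^sub>C x = r *\<^sub>R x"
    and cinner_add_left: "cinner (x + y) z = cinner x z + cinner y z"
    and cinner_scaleC_left: "cinner (a *\<^sub>C x) y = a * cinner x y"
    and cinner_commute: "cinner x y = cnj (cinner y x)"
    and Re_cinner: "Re (cinner x y) = inner x y"

class separable_chilbert = complex_inner + banach + second_countable_topology

instantiation prod :: (complex_inner, complex_inner) complex_inner
begin

definition scaleC_prod_def:
  "scaleC c x = (c *\<^sub>C fst x, c *\<^sub>C snd x)"

definition cinner_prod_def:
  "cinner x y = cinner (fst x) (fst y) + cinner (snd x) (snd y)"

instance
proof
  fix a b :: complex and r :: real and x y z :: "'a \<times> 'b"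
  show "a *\<^sub>C (x + y) = a *\<^sub>C x + a *\<^sub>C y"
    by (simp add: scaleC_prod_def scaleC_add_right)
  show "(a + b) *\<^sub>C x = a *\<^sub>C x + b *\<^sub>C x"
    by (simp add: scaleC_prod_def scaleC_add_left)
  show "a *\<^sub>C b *\<^sub>C x = (a * b) *\<^sub>C x"
    by (simp add: scaleC_prod_def scaleC_scaleC)
  show "complex_of_real r *\<^sub>C x = r *\<^sub>R x"
    by (simp add: scaleC_prod_def scaleC_of_real scaleR_prod_def)
  show "cinner (x + y) z = cinner x z + cinner y z"
    by (simp add: cinner_prod_def cinner_add_left)
  show "cinner (a *\<^sub>C x) y = a * cinner x y"
    by (simp add: cinner_prod_def scaleC_prod_def cinner_scaleC_left distrib_left)
  show "cinner x y = cnj (cinner y x)"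
    using cinner_commute[of "fst x" "fst y"] cinner_commute[of "snd x" "snd y"]
    by (simp add: cinner_prod_def)
  show "Re (cinner x y) = inner x y"
    by (simp add: cinner_prod_def inner_prod_def Re_cinner)
qed

end

instance prod :: (separable_chilbert, separable_chilbert) separable_chilbert ..

global_interpretation complex_vector:
  vector_space "scaleC :: complex \<Rightarrow> 'a \<Rightarrow> 'a :: complex_inner"
  defines cspan = complex_vector.span
    and cdim = complex_vector.dim
proof
  fix a b :: complex and x y :: 'a
  show "1 *\<^sub>C x = x"
    using scaleC_of_real[of 1 x] by simp
qed (simp_all add: scaleC_add_right scaleC_add_left scaleC_scaleC)

definition bounded_clinear :: "('a::complex_inner \<Rightarrow> 'b::complex_inner) \<Rightarrow> bool" where
  "bounded_clinear f \<longleftrightarrow> bounded_linear f \<and> (\<forall>c x. f (c *\<^sub>C x) = c *\<^sub>C f x)"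

definition Riesz_basis :: "'i set \<Rightarrow> ('i \<Rightarrow> 'a::complex_inner) \<Rightarrow> bool" where
  "Riesz_basis I f \<longleftrightarrow> closure (cspan (f ` I)) = UNIV \<and>
    (\<exists>m M. 0 < m \<and> 0 < M \<and> (\<forall>F c. finite F \<and> F \<subseteq> I \<longrightarrow>
       m * (\<Sum>i\<in>F. (cmod (c i))\<^sup>2) \<le> (norm (\<Sum>i\<in>F. c i *\<^sub>C f i))\<^sup>2 \<and>
       (norm (\<Sum>i\<in>F. c i *\<^sub>C f i))\<^sup>2 \<le> M * (\<Sum>i\<in>F. (cmod (c i))\<^sup>2)))"


section \<open>Unbounded operators\<close>

text \<open>
  A possibly unbounded operator is given by its domain \<open>D\<close> and a function \<open>A\<close> of which only the
  values on \<open>D\<close> matter. A bounded operator has \<open>D = UNIV\<close>.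
\<close>

definition adj_dom :: "'a::complex_inner set \<Rightarrow> ('a \<Rightarrow> 'b::complex_inner) \<Rightarrow> 'b set" where
  "adj_dom D A = {y. \<exists>w. \<forall>x\<in>D. cinner (A x) y = cinner x w}"

text \<open>The description below determines a unique vector when \<open>D\<close> is dense and \<open>y \<in> adj_dom D A\<close>.\<close>

definition adj :: "'a::complex_inner set \<Rightarrow> ('a \<Rightarrow> 'b::complex_inner) \<Rightarrow> 'b \<Rightarrow> 'a" where
  "adj D A y = (THE w. \<forall>x\<in>D. cinner (A x) y = cinner x w)"

definition op_spectrum :: "'a::complex_inner set \<Rightarrow> ('a \<Rightarrow> 'a) \<Rightarrow> complex set" where
  "op_spectrum D A = {\<mu>. \<not> (\<exists>R. bounded_clinear R \<and>
     (\<forall>x. R x \<in> D \<and> \<mu> *\<^sub>C R x - A (R x) = x) \<and>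
     (\<forall>x\<in>D. R (\<mu> *\<^sub>C x - A x) = x))}"

definition point_spectrum :: "'a::complex_inner set \<Rightarrow> ('a \<Rightarrow> 'a) \<Rightarrow> complex set" where
  "point_spectrum D A = {\<mu>. \<exists>x\<in>D. x \<noteq> 0 \<and> A x = \<mu> *\<^sub>C x}"

text \<open>\<open>op_ker_pow D A \<mu> n\<close> is the kernel of the \<open>n\<close>-th power of \<open>A - \<mu>\<close> on its natural domain.\<close>

primrec op_ker_pow ::
  "'a::complex_inner set \<Rightarrow> ('a \<Rightarrow> 'a) \<Rightarrow> complex \<Rightarrow> nat \<Rightarrow> 'a set" where
  "op_ker_pow D A \<mu> 0 = {0}"
| "op_ker_pow D A \<mu> (Suc n) = {x \<in> D. A x - \<mu> *\<^sub>C x \<in> op_ker_pow D A \<mu> n}"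

definition gen_eigenspace :: "'a::complex_inner set \<Rightarrow> ('a \<Rightarrow> 'a) \<Rightarrow> complex \<Rightarrow> 'a set" where
  "gen_eigenspace D A \<mu> = (\<Union>n. op_ker_pow D A \<mu> n)"

definition gen_eigenvector :: "'a::complex_inner set \<Rightarrow> ('a \<Rightarrow> 'a) \<Rightarrow> 'a \<Rightarrow> bool" where
  "gen_eigenvector D A x \<longleftrightarrow> x \<noteq> 0 \<and> (\<exists>\<mu>. x \<in> gen_eigenspace D A \<mu>)"

text \<open>Multiplicities are algebraic.\<close>

definition finite_multiplicity :: "'a::complex_inner set \<Rightarrow> ('a \<Rightarrow> 'a) \<Rightarrow> complex \<Rightarrow> bool" where
  "finite_multiplicity D A \<mu> \<longleftrightarrow> (\<exists>B. finite B \<and> gen_eigenspace D A \<mu> \<subseteq> cspan B)"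

definition simple_eigenvalue :: "'a::complex_inner set \<Rightarrow> ('a \<Rightarrow> 'a) \<Rightarrow> complex \<Rightarrow> bool" where
  "simple_eigenvalue D A \<mu> \<longleftrightarrow> \<mu> \<in> point_spectrum D A \<and> cdim (gen_eigenspace D A \<mu>) = 1"


section \<open>Semigroups and control systems\<close>

definition C0_semigroup :: "(real \<Rightarrow> 'a::complex_inner \<Rightarrow> 'a) \<Rightarrow> bool" where
  "C0_semigroup S \<longleftrightarrow>
     (\<forall>t\<ge>0. bounded_clinear (S t)) \<and>
     (\<forall>x. S 0 x = x) \<and>
     (\<forall>s\<ge>0. \<forall>t\<ge>0. \<forall>x. S (s + t) x = S s (S t x)) \<and>
     (\<forall>x. ((\<lambda>t. S t x) \<longlongrightarrow> x) (at_right 0))"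

definition generates ::
  "'a::complex_inner set \<Rightarrow> ('a \<Rightarrow> 'a) \<Rightarrow> (real \<Rightarrow> 'a \<Rightarrow> 'a) \<Rightarrow> bool" where
  "generates D A S \<longleftrightarrow> C0_semigroup S \<and>
     (\<forall>x y. (x \<in> D \<and> A x = y) \<longleftrightarrow> ((\<lambda>h. (S h x - x) /\<^sub>R h) \<longlongrightarrow> y) (at_right 0))"

definition block_op ::
  "('y \<Rightarrow> 'y::complex_inner) \<Rightarrow> ('z \<Rightarrow> 'y) \<Rightarrow> ('z \<Rightarrow> 'z::complex_inner) \<Rightarrow> 'y \<times> 'z \<Rightarrow> 'y \<times> 'z" where
  "block_op AY AYZ AZ = (\<lambda>(y, z). (AY y + AYZ z, AZ z))"

definition L2_fun :: "real \<Rightarrow> (real \<Rightarrow> complex) \<Rightarrow> bool" where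
  "L2_fun t1 u \<longleftrightarrow> u \<in> borel_measurable (lebesgue_on {0..t1}) \<and>
     integrable (lebesgue_on {0..t1}) (\<lambda>t. (cmod (u t))\<^sup>2)"

definition L2_inner :: "real \<Rightarrow> (real \<Rightarrow> complex) \<Rightarrow> (real \<Rightarrow> complex) \<Rightarrow> complex" where
  "L2_inner t1 f g = (LINT t|lebesgue_on {0..t1}. f t * cnj (g t))"

definition mild_solution ::
  "(real \<Rightarrow> 'a \<Rightarrow> 'a::separable_chilbert) \<Rightarrow> 'a \<Rightarrow> 'a \<Rightarrow> (real \<Rightarrow> complex) \<Rightarrow> real \<Rightarrow> 'a" where
  "mild_solution S b x0 u t = S t x0 + (LINT \<tau>|lebesgue_on {0..t}. S (t - \<tau>) (u \<tau> *\<^sub>C b))"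

definition proj_Y :: "'y \<times> 'z::zero \<Rightarrow> 'y \<times> 'z" where
  "proj_Y = (\<lambda>(y, z). (y, 0))"

definition partially_null_controllable ::
  "(real \<Rightarrow> 'y \<times> 'z \<Rightarrow> 'y::separable_chilbert \<times> 'z::separable_chilbert) \<Rightarrow> 'y \<times> 'z \<Rightarrow> real \<Rightarrow> bool"
  where
  "partially_null_controllable S b t1 \<longleftrightarrow>
     (\<forall>x0. \<exists>u. L2_fun t1 u \<and> proj_Y (mild_solution S b x0 u t1) = 0)"

definition b_fun ::
  "(real \<Rightarrow> 'z \<Rightarrow> 'z) \<Rightarrow> (nat \<Rightarrow> complex) \<Rightarrow> (nat \<Rightarrow> 'y \<times> 'z) \<Rightarrow>
   'y::complex_inner \<times> 'z::complex_inner \<Rightarrow> real \<Rightarrow> nat \<Rightarrow> real \<Rightarrow> complex" where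
  "b_fun SZ ev \<psi> b t1 j t = cinner b (\<psi> j) -
     exp (ev j * of_real t) * exp (- ev j * of_real t1) * cinner (SZ (t1 - t) (snd b)) (snd (\<psi> j))"


section \<open>Strong minimality\<close>

definition gram :: "('v \<Rightarrow> 'v \<Rightarrow> complex) \<Rightarrow> (nat \<Rightarrow> 'v) \<Rightarrow> nat \<Rightarrow> complex mat" where
  "gram ip x n = Matrix.mat n n (\<lambda>(i, j). ip (x i) (x j))"

text \<open>
  Gram matrices are Hermitian, so their eigenvalues are real. For \<open>n = 0\<close> there is no eigenvalue
  and the value is irrelevant.
\<close>

definition least_gram_eigenvalue :: "('v \<Rightarrow> 'v \<Rightarrow> complex) \<Rightarrow> (nat \<Rightarrow> 'v) \<Rightarrow> nat \<Rightarrow> real" where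
  "least_gram_eigenvalue ip x n = Min (Re ` spectrum (gram ip x n))"

text \<open>
  A family indexed by \<open>J \<subseteq> \<nat>\<close> is read as the sequence given by the increasing enumeration of \<open>J\<close>
  (for finite \<open>J\<close>, the function \<open>enumerate J\<close> lists \<open>J\<close> on \<open>{..<card J}\<close>). The inner product is
  a parameter since \<open>L\<^sub>2\<close> is represented by functions. The empty family is strongly minimal.
\<close>

definition strongly_minimal ::
  "('v \<Rightarrow> 'v \<Rightarrow> complex) \<Rightarrow> (nat \<Rightarrow> 'v) \<Rightarrow> nat set \<Rightarrow> bool" where
  "strongly_minimal ip f J \<longleftrightarrow>
     (if finite J
      then J = {} \<or> 0 < least_gram_eigenvalue ip (f \<circ> enumerate J) (card J)
      else \<exists>L>0. (\<lambda>n. least_gram_eigenvalue ip (f \<circ> enumerate J) n) \<longlonglongrightarrow> L)"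

end

(*
  Pairing the Y-component of the mild solution at time t1 with psi_Yj and multiplying by
  exp (-lambda_j t1) turns P x(t1) = 0 into the moment problem
    int f_j u = - ((x0, psi_j) - exp (-lambda_j t1) (S_Z(t1) x0_Z, psi_Zj)),   j in I_Y,
  for f_j(t) = exp (-lambda_j t) b_j(t). The series hypothesis and Bessel's inequality make the
  right-hand sides square-summable, and with x0_Z = 0 they range over all of l2. Such a moment
  problem is solvable for every l2 sequence iff m sum |a_j|^2 <= ||sum a_j f_j||^2 for some m > 0
  and all finite families a: one direction is the Riesz representation theorem in L2, the other is
  the uniform boundedness principle. By the variational description of the least eigenvalue of a
  Gram matrix, that inequality is strong minimality.

  The semigroups are only needed on eigenvectors of A, whose span is dense; there
  S(t) phi_i = exp (lambda_i t) phi_i.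
*)
theory Submission
  imports Defs "HOL-Real_Asymp.Real_Asymp"
begin

section \<open>Complex inner products\<close>

text \<open>The obstacle in testing the Y-component is that \<open>\<psi> j\<close> with
  \<open>j \<in> IY\<close> also has a Z-part. The pairing of the whole state with
  \<open>\<psi> j\<close> evolves by a scalar exponential; the pairing of the Y-component alone does
  not. The difference is a term in \<open>SZ\<close>, the origin of the second summand of
  \<open>b_fun\<close> and of the series in the hypothesis: Bessel's inequality controls the pairing
  of \<open>x0\<close> with \<open>\<psi> j\<close>, and the series controls what remains. Elements
  of L2 are represented by functions, so \<open>L2_sq\<close> is the square of a seminorm and L2 is
  not a type of class \<open>banach\<close>. This decides where the abstract theorems are used:
  completeness and the Riesz representation are proved for functions, while uniform boundedness is
  applied to functionals on the Hilbert space Y. Questions about Gram matrices become questions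
  about quadratic forms on finite index sets, which are easy to restrict and reindex.\<close>

lemma cinner_add_right: "cinner x (y + z) = cinner x y + cinner x (z :: 'a::complex_inner)"
  by (metis cinner_add_left cinner_commute complex_cnj_add)

lemma cinner_scaleC_right: "cinner x (a *\<^sub>C y) = cnj a * cinner x (y :: 'a::complex_inner)"
  by (metis cinner_commute cinner_scaleC_left complex_cnj_mult)

lemma cinner_zero_left [simp]: "cinner 0 (x :: 'a::complex_inner) = 0"
  using cinner_add_left[of 0 0 x] by simp

lemma cinner_zero_right [simp]: "cinner (x :: 'a::complex_inner) 0 = 0"
  using cinner_add_right[of x 0 0] by simp

lemma cinner_sum_left: "cinner (\<Sum>i\<in>F. f i) (x :: 'a::complex_inner) = (\<Sum>i\<in>F. cinner (f i) x)"
  by (induction F rule: infinite_finite_induct) (auto simp: cinner_add_left)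

lemma cinner_sum_right: "cinner (x :: 'a::complex_inner) (\<Sum>i\<in>F. f i) = (\<Sum>i\<in>F. cinner x (f i))"
  by (induction F rule: infinite_finite_induct) (auto simp: cinner_add_right)

lemma cinner_scaleR_left: "cinner (r *\<^sub>R x) (y :: 'a::complex_inner) = of_real r * cinner x y"
  by (metis cinner_scaleC_left scaleC_of_real)

lemma cinner_self: "cinner x x = of_real ((norm (x :: 'a::complex_inner))\<^sup>2)"
proof (rule complex_eqI)
  show "Re (cinner x x) = Re (of_real ((norm x)\<^sup>2))"
    by (simp add: Re_cinner power2_norm_eq_inner)
  show "Im (cinner x x) = Im (of_real ((norm x)\<^sup>2))"
    using arg_cong[OF cinner_commute[of x x], of Im] by simp
qed

lemma norm_scaleC: "norm (a *\<^sub>C x) = cmod a * norm (x :: 'a::complex_inner)"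
proof (rule power2_eq_imp_eq)
  have "complex_of_real ((norm (a *\<^sub>C x))\<^sup>2) = a * cnj a * of_real ((norm x)\<^sup>2)"
    by (simp only: cinner_self[symmetric] cinner_scaleC_left cinner_scaleC_right mult_ac)
  also have "\<dots> = of_real ((cmod a * norm x)\<^sup>2)"
    by (simp add: complex_norm_square[symmetric] power_mult_distrib)
  finally show "(norm (a *\<^sub>C x))\<^sup>2 = (cmod a * norm x)\<^sup>2"
    using of_real_eq_iff by blast
qed auto

lemma cmod_cinner_le: "cmod (cinner x y) \<le> norm x * norm (y :: 'a::complex_inner)"
proof (cases "cinner x y = 0")
  case False
  \<comment> \<open>Rotating \<open>x\<close> by the unimodular \<open>u\<close> makes the inner
    product real and equal to its modulus, so the real Cauchy-Schwarz inequality applies.\<close>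
  define u where "u = cnj (cinner x y) / of_real (cmod (cinner x y))"
  have u: "cmod u = 1" using False by (simp add: u_def norm_divide)
  have "cinner (u *\<^sub>C x) y = of_real (cmod (cinner x y))"
    using False complex_norm_square[of "cinner x y"]
    by (simp add: cinner_scaleC_left u_def power2_eq_square mult.commute divide_simps)
  then have "cmod (cinner x y) = inner (u *\<^sub>C x) y"
    by (metis Re_cinner Re_complex_of_real)
  also have "\<dots> \<le> norm (u *\<^sub>C x) * norm y" by (rule norm_cauchy_schwarz)
  finally show ?thesis by (simp add: norm_scaleC u)
qed simp

lemma bounded_linear_cinner_left: "bounded_linear (\<lambda>x. cinner x (y :: 'a::complex_inner))"
  by (rule bounded_linear_intro[where K = "norm y"])
    (auto simp: cinner_add_left cinner_scaleR_left scaleR_conv_of_real cmod_cinner_le)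

lemma bounded_bilinear_scaleC:
  "bounded_bilinear (scaleC :: complex \<Rightarrow> 'a \<Rightarrow> 'a::complex_inner)"
proof
  fix a a' :: complex and b b' :: 'a and r :: real
  show "(a + a') *\<^sub>C b = a *\<^sub>C b + a' *\<^sub>C b" by (rule scaleC_add_left)
  show "a *\<^sub>C (b + b') = a *\<^sub>C b + a *\<^sub>C b'" by (rule scaleC_add_right)
  show "(r *\<^sub>R a) *\<^sub>C b = r *\<^sub>R (a *\<^sub>C b)"
    by (simp only: scaleR_conv_of_real scaleC_scaleC[symmetric] scaleC_of_real)
  have "a *\<^sub>C (complex_of_real r *\<^sub>C b) = complex_of_real r *\<^sub>C (a *\<^sub>C b)"
    by (simp only: scaleC_scaleC mult.commute)
  then show "a *\<^sub>C (r *\<^sub>R b) = r *\<^sub>R (a *\<^sub>C b)" by (simp only: scaleC_of_real)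
  show "\<exists>K. \<forall>a b. norm (a *\<^sub>C b :: 'a) \<le> norm a * norm b * K"
    by (rule exI[of _ 1]) (simp add: norm_scaleC)
qed

lemma fst_scaleC: "fst (c *\<^sub>C x) = c *\<^sub>C fst x"
  by (simp add: scaleC_prod_def)

lemma snd_scaleC: "snd (c *\<^sub>C x) = c *\<^sub>C snd x"
  by (simp add: scaleC_prod_def)

text \<open>\<open>bounded_linear\<close> is only real linearity, so agreement is asked for on all
  complex multiples of elements of \<open>B\<close>; sums of these exhaust the dense
  subspace.\<close>

lemma bounded_linear_eq_cspan:
  fixes f g :: "'a::complex_inner \<Rightarrow> 'b::real_normed_vector"
  assumes f: "bounded_linear f" and g: "bounded_linear g"
    and dense: "closure (cspan B) = UNIV" and eq: "\<And>c x. x \<in> B \<Longrightarrow> f (c *\<^sub>C x) = g (c *\<^sub>C x)"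
  shows "f x = g x"
proof -
  have bl: "bounded_linear (\<lambda>x. f x - g x)"
    using f g by (rule bounded_linear_sub)
  have "f x - g x = 0" if "x \<in> cspan B" for x
    using that
  proof (induction rule: complex_vector.span_induct_alt)
    case base
    show ?case using f g by (simp add: linear_simps)
  next
    case (step c x y)
    then show ?case
      using f g eq[of x c] by (simp add: linear_simps)
  qed
  then have "cspan B \<subseteq> {x. f x - g x = 0}" by blast
  moreover have "closed {x. f x - g x = 0}"
    by (intro closed_Collect_eq linear_continuous_on bl continuous_on_const)
  ultimately have "closure (cspan B) \<subseteq> {x. f x - g x = 0}" by (rule closure_minimal)
  then show ?thesis using dense by auto
qed

section \<open>Uniform boundedness\<close>

text \<open>Banach-Steinhaus: the closed sets \<open>T n\<close> cover the space, so by Baire one of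
  them contains a ball, and a bound on a ball rescales to a bound on the operator norms.\<close>

lemma uniform_boundedness:
  fixes F :: "('a::banach \<Rightarrow> 'b::real_normed_vector) set"
  assumes lin: "\<And>f. f \<in> F \<Longrightarrow> bounded_linear f"
    and ptw: "\<And>x. \<exists>B. \<forall>f\<in>F. norm (f x) \<le> B"
  shows "\<exists>B. \<forall>f\<in>F. \<forall>x. norm (f x) \<le> B * norm x"
proof -
  define T where "T n = {x. \<forall>f\<in>F. norm (f x) \<le> real n}" for n
  have closed_T: "closed (T n)" for n
  proof -
    have "T n = (\<Inter>f\<in>F. {x. norm (f x) \<le> real n})" by (auto simp: T_def)
    moreover have "closed {x. norm (f x) \<le> real n}" if "f \<in> F" for f
      using lin[OF that] by (intro closed_Collect_le continuous_on_norm linear_continuous_on continuous_on_const)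
    ultimately show ?thesis by auto
  qed
  have "\<Union>(range T) = UNIV"
  proof safe
    fix x
    obtain B where "\<forall>f\<in>F. norm (f x) \<le> B" using ptw by blast
    moreover obtain n where "B \<le> real n" using real_arch_simple by blast
    ultimately have "x \<in> T n" by (force simp: T_def)
    then show "x \<in> \<Union>(range T)" by blast
  qed auto
  have "\<exists>n. interior (T n) \<noteq> {}"
  proof (rule ccontr)
    assume "\<nexists>n. interior (T n) \<noteq> {}"
    then have "(euclidean :: 'a topology) interior_of \<Union>(range T) = {}"
      using closed_T
      by (intro Baire_category_alt) (auto simp: completely_metrizable_space_euclidean)
    then show False using \<open>\<Union>(range T) = UNIV\<close> by simp
  qed
  then obtain n a r where r: "r > 0" "ball a r \<subseteq> T n"
    by (metis ex_in_conv interior_subset mem_interior subset_trans)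
  have "norm (f x) \<le> (4 * real n / r) * norm x" if f: "f \<in> F" for f x
  proof (cases "x = 0")
    case True
    then show ?thesis using lin[OF f] by (simp add: linear_simps)
  next
    case False
    \<comment> \<open>\<open>s *\<^sub>R x\<close> has norm r/2 and so stays inside the ball. The
      bound n at \<open>a\<close> and at \<open>a + s *\<^sub>R x\<close> gives 2n for the
      difference; division by \<open>s\<close> produces the constant 4n/r.\<close>
    define s where "s = r / (2 * norm x)"
    have s: "s > 0" using r False by (simp add: s_def)
    have "a + s *\<^sub>R x \<in> ball a r" "a \<in> ball a r"
      using r False by (auto simp: dist_norm s_def)
    then have "norm (f (a + s *\<^sub>R x)) \<le> n" "norm (f a) \<le> n"
      using subsetD[OF r(2)] f unfolding T_def by blast+
    moreover have "s *\<^sub>R f x = f (a + s *\<^sub>R x) - f a"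
      using lin[OF f] by (simp add: linear_simps)
    ultimately have "norm (s *\<^sub>R f x) \<le> 2 * n"
      using norm_triangle_ineq4[of "f (a + s *\<^sub>R x)" "f a"] by simp
    then have "s * norm (f x) \<le> 2 * n" using s by simp
    then show ?thesis using r False by (simp add: s_def field_simps)
  qed
  then show ?thesis by blast
qed

section \<open>Strongly continuous semigroups\<close>

lemma C0_semigroup_bounded_linear: "C0_semigroup S \<Longrightarrow> t \<ge> 0 \<Longrightarrow> bounded_linear (S t)"
  by (simp add: C0_semigroup_def bounded_clinear_def)

lemma C0_semigroup_scaleC: "C0_semigroup S \<Longrightarrow> t \<ge> 0 \<Longrightarrow> S t (c *\<^sub>C x) = c *\<^sub>C S t x"
  by (simp add: C0_semigroup_def bounded_clinear_def)

lemma C0_semigroup_zero: "C0_semigroup S \<Longrightarrow> S 0 x = x"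
  by (simp add: C0_semigroup_def)

lemma C0_semigroup_add: "C0_semigroup S \<Longrightarrow> s \<ge> 0 \<Longrightarrow> t \<ge> 0 \<Longrightarrow> S (s + t) x = S s (S t x)"
  by (simp add: C0_semigroup_def)

lemma C0_semigroup_continuous_at_0:
  assumes "C0_semigroup S"
  shows "continuous (at 0 within {0..}) (\<lambda>t. S t x)"
  using assms unfolding C0_semigroup_def at_within_Ici_at_right continuous_within
  by metis

text \<open>If no bound held near 0, there would be times tending to 0 with operator norms tending
  to infinity. Strong continuity at 0 makes these operators pointwise bounded, which contradicts
  uniform boundedness.\<close>

lemma C0_semigroup_locally_bounded:
  fixes S :: "real \<Rightarrow> 'a \<Rightarrow> 'a::{complex_inner,banach}"
  assumes S: "C0_semigroup S"
  shows "\<exists>\<delta>>0. \<exists>B. \<forall>t\<in>{0..\<delta>}. \<forall>x. norm (S t x) \<le> B * norm x"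
proof (rule ccontr)
  assume "\<not> ?thesis"
  then have "\<exists>t\<in>{0..inverse (real (Suc n))}. \<exists>x. norm (S t x) > real n * norm x" for n
    by (metis inverse_positive_iff_positive not_le of_nat_0_less_iff zero_less_Suc)
  then obtain t where t: "\<And>n. t n \<in> {0..inverse (real (Suc n))}"
    and t_unbounded: "\<And>n. \<exists>x. norm (S (t n) x) > real n * norm x"
    by metis
  have t0: "t \<longlonglongrightarrow> 0"
    by (rule tendsto_sandwich[OF _ _ tendsto_const LIMSEQ_inverse_real_of_nat]) (use t in auto)
  have ptw: "\<exists>B. \<forall>f\<in>range (\<lambda>n. S (t n)). norm (f x) \<le> B" for x
  proof -
    have "(\<lambda>n. S (t n) x) \<longlonglongrightarrow> S 0 x"
      using t by (intro continuous_within_tendsto_compose'[OF C0_semigroup_continuous_at_0[OF S] _ t0]) auto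
    then have "Bseq (\<lambda>n. S (t n) x)"
      by (metis convergentI convergent_imp_Bseq)
    then show ?thesis by (auto simp: Bseq_def)
  qed
  have lin: "bounded_linear f" if "f \<in> range (\<lambda>n. S (t n))" for f
    using that t C0_semigroup_bounded_linear[OF S] by (metis atLeastAtMost_iff imageE)
  have "\<exists>B. \<forall>f\<in>range (\<lambda>n. S (t n)). \<forall>x. norm (f x) \<le> B * norm x"
    by (rule uniform_boundedness) (fact lin, fact ptw)
  then obtain B where "\<forall>f\<in>range (\<lambda>n. S (t n)). \<forall>x. norm (f x) \<le> B * norm x" ..
  then have B: "norm (S (t n) x) \<le> B * norm x" for n x
    by simp
  obtain n where "B \<le> real n" using real_arch_simple by blast
  then have "norm (S (t n) x) \<le> real n * norm x" for x
    using B[of n x] by (meson mult_right_mono norm_ge_zero order_trans)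
  then show False using t_unbounded[of n] by (meson not_le)
qed

lemma C0_semigroup_bounded:
  fixes S :: "real \<Rightarrow> 'a \<Rightarrow> 'a::{complex_inner,banach}"
  assumes S: "C0_semigroup S"
  obtains B where "B \<ge> 0" "\<And>t x. t \<in> {0..T} \<Longrightarrow> norm (S t x) \<le> B * norm x"
proof -
  obtain \<delta> B where \<delta>: "\<delta> > 0" and B: "\<And>t x. t \<in> {0..\<delta>} \<Longrightarrow> norm (S t x) \<le> B * norm x"
    using C0_semigroup_locally_bounded[OF S] by blast
  \<comment> \<open>A time up to \<open>n * \<delta>\<close> is reached in at most n steps of length
    at most \<open>\<delta>\<close>. Taking \<open>C\<close> at least 1 lets \<open>C ^ n\<close>
    cover shorter times too.\<close>
  define C where "C = max 1 B"
  have C: "norm (S t x) \<le> C * norm x" if "t \<in> {0..\<delta>}" for t x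
    using B[OF that, of x] by (smt (verit) C_def mult_right_mono norm_ge_zero)
  have C1: "C \<ge> 1" by (simp add: C_def)
  have *: "norm (S t x) \<le> C ^ n * norm x" if "t \<in> {0..real n * \<delta>}" for n t x
    using that
  proof (induction n arbitrary: t)
    case 0
    then show ?case using C0_semigroup_zero[OF S] by simp
  next
    case (Suc n)
    show ?case
    proof (cases "t \<le> \<delta>")
      case True
      then have "norm (S t x) \<le> C * norm x" using Suc.prems C by simp
      also have "\<dots> \<le> C ^ Suc n * norm x"
        using C1 by (intro mult_right_mono) (auto simp: one_le_power)
      finally show ?thesis .
    next
      case False
      have "S t x = S \<delta> (S (t - \<delta>) x)"
        using C0_semigroup_add[OF S, of \<delta> "t - \<delta>" x] \<delta> False by simp
      then have "norm (S t x) \<le> C * norm (S (t - \<delta>) x)" using C \<delta> by simp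
      also have "\<dots> \<le> C * (C ^ n * norm x)"
        using C1 Suc False by (intro mult_left_mono) (auto simp: algebra_simps)
      finally show ?thesis by simp
    qed
  qed
  obtain n where n: "T < real n * \<delta>" using \<delta> ex_less_of_nat_mult by blast
  show ?thesis
    by (rule that[of "C ^ n"]) (use C1 n * in auto)
qed

text \<open>With r the smaller of two times, the increment is S(r) applied to
  \<open>S h x - x\<close>. Local boundedness and continuity at 0 thus settle both one-sided limits
  with the same estimate.\<close>

lemma C0_semigroup_continuous_on:
  fixes S :: "real \<Rightarrow> 'a \<Rightarrow> 'a::{complex_inner,banach}"
  assumes S: "C0_semigroup S"
  shows "continuous_on {0..} (\<lambda>t. S t x)"
proof (unfold continuous_on_iff, intro ballI allI impI)
  fix t :: real and e :: real
  assume t: "t \<in> {0..}" and e: "e > 0"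
  obtain B where B: "B \<ge> 0" "\<And>s x. s \<in> {0..t + 1} \<Longrightarrow> norm (S s x) \<le> B * norm x"
    using C0_semigroup_bounded[OF S] by blast
  \<comment> \<open>The divisor is \<open>B + 1\<close> because \<open>B\<close> may be 0.\<close>
  have "e / (B + 1) > 0" using e B by simp
  then obtain d where d: "d > 0" "\<And>s. s \<in> {0..} \<Longrightarrow> s < d \<Longrightarrow> norm (S s x - x) < e / (B + 1)"
    using C0_semigroup_continuous_at_0[OF S, of x, unfolded continuous_within_eps_delta]
    by (force simp: C0_semigroup_zero[OF S] dist_norm)
  have *: "norm (S (r + h) x - S r x) < e" if "r \<in> {0..t + 1}" "h \<in> {0..<d}" for r h
  proof -
    have "S (r + h) x - S r x = S r (S h x - x)"
      using that C0_semigroup_bounded_linear[OF S, of r]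
      by (simp add: C0_semigroup_add[OF S] linear_simps)
    then have "norm (S (r + h) x - S r x) \<le> B * norm (S h x - x)" using B that by simp
    also have "\<dots> \<le> B * (e / (B + 1))"
      using B d(2)[of h] that by (intro mult_left_mono) auto
    also have "\<dots> < e" using B e by (simp add: field_simps)
    finally show ?thesis .
  qed
  show "\<exists>d>0. \<forall>s\<in>{0..}. dist s t < d \<longrightarrow> dist (S s x) (S t x) < e"
  proof (intro exI[of _ "min d 1"] conjI ballI impI)
    fix s assume s: "s \<in> {0..}" "dist s t < min d 1"
    show "dist (S s x) (S t x) < e"
    proof (cases "s \<ge> t")
      case True
      then show ?thesis using s t *[of t "s - t"] by (auto simp: dist_norm)
    next
      case False
      then show ?thesis
        using s t *[of s "t - s"] by (auto simp: dist_norm norm_minus_commute)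
    qed
  qed (use d in auto)
qed

text \<open>Telescoping \<open>S(t/N)\<^sup>N x - e\<^bsup>\<mu>t\<^esup> x\<close> avoids differentiating \<open>S(t)x\<close> at \<open>t > 0\<close>.\<close>

lemma generates_eigenvector:
  fixes S :: "real \<Rightarrow> 'a \<Rightarrow> 'a::{complex_inner,banach}"
  assumes gen: "generates D A S" and x: "x \<in> D" "A x = \<mu> *\<^sub>C x" and t: "t \<ge> 0"
  shows "S t x = exp (\<mu> * of_real t) *\<^sub>C x"
proof (cases "t = 0")
  case True
  then show ?thesis using gen scaleC_of_real[of 1 x] by (simp add: generates_def C0_semigroup_zero)
next
  case False
  with t have t: "t > 0" by simp
  have S: "C0_semigroup S" using gen by (simp add: generates_def)
  obtain B where B: "B \<ge> 0" "\<And>s x. s \<in> {0..t} \<Longrightarrow> norm (S s x) \<le> B * norm x"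
    using C0_semigroup_bounded[OF S] by blast
  \<comment> \<open>An exponential growth rate that works for either sign of \<open>Re \<mu>\<close>
    and is nonnegative, so that \<open>exp (a * s)\<close> is at least 1.\<close>
  define a where "a = \<bar>Re \<mu>\<bar>"
  have a: "cmod (exp (\<mu> * of_real s)) \<le> exp (a * s)" if "s \<ge> 0" for s
    using that by (auto simp: a_def mult_right_mono)
  define E where "E h = S h x - exp (\<mu> * of_real h) *\<^sub>C x" for h
  have telescope: "norm (E (real n * h)) \<le> real n * (B * norm (E h)) * exp (a * (real n * h))"
    if h: "h \<ge> 0" "real n * h \<le> t" for n h
    using h(2)
  proof (induction n)
    case 0
    show ?case
      using scaleC_of_real[of 1 x] by (simp add: C0_semigroup_zero[OF S] E_def)
  next
    case (Suc n)
    define s where "s = real n * h"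
    have s: "0 \<le> s" "s + h \<le> t" "real (Suc n) * h = s + h"
      using h(1) Suc.prems by (auto simp: s_def algebra_simps)
    \<comment> \<open>One telescoping step: the new error is a one-step error transported by the
      semigroup, plus the old error multiplied by the scalar exponential.\<close>
    have "E (s + h) = S s (E h) + exp (\<mu> * of_real h) *\<^sub>C E s"
      using C0_semigroup_add[OF S, of s h x] s h(1) C0_semigroup_bounded_linear[OF S, of s]
      by (simp add: E_def linear_simps C0_semigroup_scaleC[OF S] scaleC_scaleC distrib_left exp_add
          bounded_bilinear.diff_right[OF bounded_bilinear_scaleC] mult.commute)
    also have "norm \<dots> \<le> B * norm (E h) + cmod (exp (\<mu> * of_real h)) * norm (E s)"
      using B(2)[of s "E h"] s h by (intro norm_triangle_mono) (auto simp: norm_scaleC)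
    also have "\<dots> \<le> B * norm (E h) * exp (a * (s + h))
        + exp (a * h) * (real n * (B * norm (E h)) * exp (a * s))"
    proof (rule add_mono[OF _ mult_mono])
      have "exp (a * (s + h)) \<ge> 1" using s h by (simp add: a_def)
      then show "B * norm (E h) \<le> B * norm (E h) * exp (a * (s + h))"
        using B(1) mult_left_mono[of 1 "exp (a * (s + h))" "B * norm (E h)"] by simp
      show "norm (E s) \<le> real n * (B * norm (E h)) * exp (a * s)"
        using Suc.IH s h by (simp add: s_def)
    qed (use a h(1) in auto)
    also have "\<dots> = real (Suc n) * (B * norm (E h)) * exp (a * (s + h))"
      by (simp add: algebra_simps exp_add)
    finally show ?case using s(3) by simp
  qed
  \<comment> \<open>The one-step error is o(h), since the difference quotients of
    \<open>S h x\<close> and of the scalar exponential times \<open>x\<close> have the same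
    limit.\<close>
  have "((\<lambda>h. (S h x - x) /\<^sub>R h) \<longlongrightarrow> \<mu> *\<^sub>C x) (at_right 0)"
    using gen x unfolding generates_def by blast
  moreover have "((\<lambda>h. ((exp (\<mu> * of_real h) - 1) / of_real h) *\<^sub>C x) \<longlongrightarrow> \<mu> *\<^sub>C x) (at_right 0)"
  proof (rule bounded_bilinear.tendsto[OF bounded_bilinear_scaleC _ tendsto_const])
    have "((\<lambda>z. exp (\<mu> * z)) has_field_derivative \<mu>) (at 0)"
      by (auto intro!: derivative_eq_intros)
    then have "((\<lambda>z. (exp (\<mu> * z) - 1) / z) \<longlongrightarrow> \<mu>) (at 0)"
      by (simp add: DERIV_def)
    moreover have "filterlim complex_of_real (at 0) (at_right 0)"
      unfolding filterlim_at using tendsto_of_real[OF tendsto_ident_at, of 0 "{0<..}", where 'a = complex]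
      by (auto simp: eventually_at_filter)
    ultimately show "((\<lambda>h::real. (exp (\<mu> * of_real h) - 1) / of_real h) \<longlongrightarrow> \<mu>) (at_right 0)"
      by (rule filterlim_compose)
  qed
  ultimately have "((\<lambda>h. (S h x - x) /\<^sub>R h - ((exp (\<mu> * of_real h) - 1) / of_real h) *\<^sub>C x)
      \<longlongrightarrow> \<mu> *\<^sub>C x - \<mu> *\<^sub>C x) (at_right 0)"
    by (rule tendsto_diff)
  then have "((\<lambda>h. norm ((S h x - x) /\<^sub>R h - ((exp (\<mu> * of_real h) - 1) / of_real h) *\<^sub>C x)) \<longlongrightarrow> 0)
      (at_right 0)"
    unfolding diff_self by (rule tendsto_norm_zero)
  moreover have "\<forall>\<^sub>F h in at_right 0. norm ((S h x - x) /\<^sub>R h - ((exp (\<mu> * of_real h) - 1) / of_real h) *\<^sub>C x)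
      = norm (E h) / h"
    unfolding eventually_at_right_field
  proof (intro exI[of _ 1] conjI allI impI)
    fix h :: real assume h: "0 < h"
    have "(S h x - x) /\<^sub>R h - ((exp (\<mu> * of_real h) - 1) / of_real h) *\<^sub>C x = E h /\<^sub>R h"
    proof -
      have "((exp (\<mu> * of_real h) - 1) / of_real h) *\<^sub>C x
          = complex_of_real (inverse h) *\<^sub>C (exp (\<mu> * of_real h) - 1) *\<^sub>C x"
        by (simp only: scaleC_scaleC) (simp add: divide_inverse mult.commute)
      also have "\<dots> = (exp (\<mu> * of_real h) *\<^sub>C x - x) /\<^sub>R h"
        using scaleC_of_real[of 1 x]
        by (simp only: scaleC_of_real bounded_bilinear.diff_left[OF bounded_bilinear_scaleC]) simp
      finally show ?thesis
        by (simp add: E_def scaleR_diff_right)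
    qed
    then show "norm ((S h x - x) /\<^sub>R h - ((exp (\<mu> * of_real h) - 1) / of_real h) *\<^sub>C x) = norm (E h) / h"
      using h by (simp add: divide_inverse mult.commute)
  qed auto
  ultimately have "((\<lambda>h. norm (E h) / h) \<longlongrightarrow> 0) (at_right 0)"
    by (rule Lim_transform_eventually)
  moreover have "filterlim (\<lambda>n. t / real (Suc n)) (at_right 0) sequentially"
    using t by real_asymp
  ultimately have lim: "(\<lambda>n. norm (E (t / real (Suc n))) / (t / real (Suc n))) \<longlonglongrightarrow> 0"
    by (rule filterlim_compose)
  \<comment> \<open>With step h = t/(n+1), the n+1 one-step errors add up to t times
    \<open>norm (E h) / h\<close>, which tends to 0; the left side does not depend on n.\<close>
  have "norm (E t) \<le> (B * t * exp (a * t)) * (norm (E (t / real (Suc n))) / (t / real (Suc n)))" for n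
    using telescope[of "t / real (Suc n)" "Suc n"] t
    by (simp del: of_nat_Suc add: mult_ac)
  then have "norm (E t) \<le> (B * t * exp (a * t)) * 0"
    by (intro tendsto_lowerbound[OF tendsto_mult[OF tendsto_const lim]]) auto
  then show ?thesis by (simp add: E_def)
qed

section \<open>Least eigenvalues of Gram matrices\<close>

text \<open>The value v^* K v of the matrix K = (\<open>k i j\<close>). For a Gram kernel it is the
  squared norm of the combination of the vectors with coefficients \<open>cnj (v i)\<close>, which
  explains the conjugates in the later combinations. The real part makes it a real number without a
  prior proof of Hermitian symmetry.\<close>

definition kernel_form :: "(nat \<Rightarrow> nat \<Rightarrow> complex) \<Rightarrow> nat set \<Rightarrow> (nat \<Rightarrow> complex) \<Rightarrow> real" where
  "kernel_form k F v = Re (\<Sum>i\<in>F. \<Sum>j\<in>F. cnj (v i) * v j * k i j)"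

locale psd_kernel =
  fixes k :: "nat \<Rightarrow> nat \<Rightarrow> complex" and n :: nat
  assumes hermitian: "k j i = cnj (k i j)"
    and nonneg: "kernel_form k {..<n} v \<ge> 0"
begin

text \<open>The form along a line in the direction of the i-th unit vector is an explicit quadratic
  in \<open>s\<close>; Hermitian symmetry merges the two cross terms into twice a real part.\<close>

lemma form_add_unit:
  assumes "i < n"
  shows "kernel_form k {..<n} (\<lambda>j. v j + (if j = i then s else 0)) =
    kernel_form k {..<n} v + 2 * Re (cnj s * (\<Sum>j<n. k i j * v j)) + (cmod s)\<^sup>2 * Re (k i i)"
proof -
  define w where "w = (\<Sum>j<n. k i j * v j)"
  define e where "e j = (if j = i then s else 0)" for j
  have e_sum: "(\<Sum>j<n. e j * f j) = s * f i" "(\<Sum>j<n. cnj (e j) * f j) = cnj s * f i" for f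
    using assms by (simp_all add: e_def if_distrib[of cnj] if_distrib[of "\<lambda>x. x * _"] cong: if_cong)
  have "(\<Sum>a<n. \<Sum>j<n. cnj (v a + e a) * (v j + e j) * k a j) =
    (\<Sum>a<n. \<Sum>j<n. cnj (v a) * v j * k a j) + (\<Sum>a<n. cnj (v a) * (\<Sum>j<n. e j * k a j))
     + (\<Sum>a<n. cnj (e a) * (\<Sum>j<n. k a j * v j)) + (\<Sum>a<n. cnj (e a) * (\<Sum>j<n. e j * k a j))"
    by (simp add: sum.distrib sum_distrib_left algebra_simps)
  also have "\<dots> = (\<Sum>a<n. \<Sum>j<n. cnj (v a) * v j * k a j) + s * cnj w + cnj s * w + cnj s * s * k i i"
  proof -
    have "(\<Sum>a<n. cnj (v a) * (s * k a i)) = s * cnj w"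
      unfolding w_def cnj_sum sum_distrib_left by (rule sum.cong) (auto simp: hermitian[of i])
    then show ?thesis by (simp only: e_sum w_def mult.assoc)
  qed
  finally have "kernel_form k {..<n} (\<lambda>j. v j + e j) = kernel_form k {..<n} v + Re (s * cnj w + cnj s * w + cnj s * s * k i i)"
    unfolding kernel_form_def by (simp only: plus_complex.sel add.assoc)
  moreover have "Re (s * cnj w + cnj s * w + cnj s * s * k i i) = 2 * Re (cnj s * w) + (cmod s)\<^sup>2 * Re (k i i)"
    using arg_cong[OF hermitian[of i i], of Im] unfolding cmod_power2
    by (simp add: algebra_simps power2_eq_square)
  ultimately show ?thesis
    unfolding e_def w_def by simp
qed

lemma diag_nonneg:
  assumes "i < n"
  shows "Re (k i i) \<ge> 0"
proof -
  have "kernel_form k {..<n} (\<lambda>_. 0) = 0" by (simp add: kernel_form_def)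
  then show ?thesis
    using nonneg[of "\<lambda>j. 0 + (if j = i then 1 else 0)"]
    unfolding form_add_unit[OF assms] by simp
qed

text \<open>A Cauchy-Schwarz inequality for a possibly degenerate form: where the form is small,
  every entry of K v is small. It follows from nonnegativity at v - r w e_i with r = 1 /
  (\<open>k i i\<close> + 1), where w is the i-th entry of K v; the added 1 covers a zero diagonal
  entry.\<close>

lemma entry_le_form:
  assumes "i < n"
  shows "(cmod (\<Sum>j<n. k i j * v j))\<^sup>2 \<le> (Re (k i i) + 1) * kernel_form k {..<n} v"
proof -
  define w where "w = (\<Sum>j<n. k i j * v j)"
  define h where "h = Re (k i i)"
  have h: "h \<ge> 0" using diag_nonneg[OF assms] by (simp add: h_def)
  define r where "r = 1 / (h + 1)"
  have r: "r > 0" "r * h \<le> 1" "r * (h + 1) = 1" using h by (auto simp: r_def field_simps)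
  have "0 \<le> kernel_form k {..<n} (\<lambda>j. v j + (if j = i then - of_real r * w else 0))"
    by (rule nonneg)
  also have "\<dots> = kernel_form k {..<n} v - 2 * r * (cmod w)\<^sup>2 + r\<^sup>2 * (cmod w)\<^sup>2 * h"
  proof -
    have "Re (cnj (- of_real r * w) * w) = - r * (cmod w)\<^sup>2"
      unfolding cmod_power2 by (simp add: power2_eq_square algebra_simps)
    moreover have "(cmod (- of_real r * w))\<^sup>2 = r\<^sup>2 * (cmod w)\<^sup>2"
      by (simp add: norm_mult power_mult_distrib)
    ultimately show ?thesis
      unfolding form_add_unit[OF assms] w_def[symmetric] h_def[symmetric] by simp
  qed
  also have "\<dots> \<le> kernel_form k {..<n} v - r * (cmod w)\<^sup>2"
  proof -
    have "(r * h) * (r * (cmod w)\<^sup>2) \<le> 1 * (r * (cmod w)\<^sup>2)"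
      using r by (intro mult_right_mono) auto
    then show ?thesis by (simp add: power2_eq_square algebra_simps)
  qed
  finally have "(h + 1) * (r * (cmod w)\<^sup>2) \<le> (h + 1) * kernel_form k {..<n} v"
    using h by (intro mult_left_mono) auto
  then show ?thesis
    unfolding w_def[symmetric] h_def[symmetric] mult.assoc[symmetric]
    using r(3) by (simp add: mult.commute)
qed

end

lemma kernel_form_shift:
  assumes "finite F"
  shows "kernel_form (\<lambda>i j. k i j - (if i = j then of_real m else 0)) F v =
    kernel_form k F v - m * (\<Sum>i\<in>F. (cmod (v i))\<^sup>2)"
proof -
  have "(\<Sum>j\<in>F. cnj (v i) * v j * (k i j - (if i = j then of_real m else 0))) =
      (\<Sum>j\<in>F. cnj (v i) * v j * k i j) - of_real m * of_real ((cmod (v i))\<^sup>2)" if "i \<in> F" for i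
    using assms that complex_norm_square[of "v i"]
    by (simp add: right_diff_distrib sum_subtractf if_distrib[of "\<lambda>x. _ * x"] cong: if_cong)
  then have "(\<Sum>i\<in>F. \<Sum>j\<in>F. cnj (v i) * v j * (k i j - (if i = j then of_real m else 0))) =
      (\<Sum>i\<in>F. \<Sum>j\<in>F. cnj (v i) * v j * k i j) - of_real (m * (\<Sum>i\<in>F. (cmod (v i))\<^sup>2))"
    by (simp add: sum_subtractf sum_distrib_left)
  then show ?thesis
    unfolding kernel_form_def by (simp only: minus_complex.sel Re_complex_of_real)
qed

context psd_kernel
begin

definition gram_mat :: "complex mat" where
  "gram_mat = Matrix.mat n n (\<lambda>(i, j). k i j)"

lemma gram_mat_mult_vec:
  "v \<in> carrier_vec n \<Longrightarrow> i < n \<Longrightarrow> vec_index (gram_mat *\<^sub>v v) i = (\<Sum>j<n. k i j * vec_index v j)"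
  by (auto simp: gram_mat_def scalar_prod_def lessThan_atLeast0 intro!: sum.cong)

text \<open>
  The supremum \<open>m\<close> of the lower bounds of the form is an eigenvalue: otherwise \<open>G - m\<close> has a
  bounded inverse, and \<open>entry_le_form\<close> applied to \<open>G - m\<close> gives a lower bound larger than \<open>m\<close>.
\<close>

lemma least_eigenvalue_gram_mat:
  assumes n: "n > 0"
  defines "l \<equiv> Min (Re ` spectrum (gram_mat))"
  shows "\<forall>v. l * (\<Sum>i<n. (cmod (v i))\<^sup>2) \<le> kernel_form k {..<n} v"
    and "(\<forall>v. m * (\<Sum>i<n. (cmod (v i))\<^sup>2) \<le> kernel_form k {..<n} v) \<Longrightarrow> m \<le> l"
proof -
  let ?N = "\<lambda>v. \<Sum>i<n. (cmod (v i))\<^sup>2"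
  define M where "M = {m. \<forall>v. m * ?N v \<le> kernel_form k {..<n} v}"
  define m0 where "m0 = Sup M"
  have M_ne: "0 \<in> M" by (simp add: M_def nonneg)
  have "x \<le> kernel_form k {..<n} (\<lambda>i. if i = 0 then 1 else 0)" if "x \<in> M" for x
  proof -
    have "?N (\<lambda>i. if i = 0 then 1 else 0) = 1"
      using n by (simp add: if_distrib[of cmod] if_distrib[of "\<lambda>x. x\<^sup>2"] cong: if_cong)
    moreover have "x * ?N (\<lambda>i. if i = 0 then 1 else 0) \<le> kernel_form k {..<n} (\<lambda>i. if i = 0 then 1 else 0)"
      by (rule spec[OF that[unfolded M_def mem_Collect_eq]])
    ultimately show ?thesis by (simp only: mult_1_right)
  qed
  then have bdd: "bdd_above M" by (rule bdd_aboveI)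
  have m0: "m0 * ?N v \<le> kernel_form k {..<n} v" for v
  proof (cases "?N v = 0")
    case True
    then show ?thesis using nonneg[of v] by simp
  next
    case False
    then have pos: "?N v > 0" by (metis less_eq_real_def sum_nonneg zero_le_power2)
    have "m0 \<le> kernel_form k {..<n} v / ?N v"
      unfolding m0_def
    proof (rule cSup_least)
      show "M \<noteq> {}" using M_ne by blast
    qed (use pos in \<open>simp add: M_def pos_le_divide_eq\<close>)
    then show ?thesis using pos by (simp add: pos_le_divide_eq)
  qed
  have G: "gram_mat \<in> carrier_mat n n" by (simp add: gram_mat_def)
  \<comment> \<open>The Rayleigh quotient at an eigenvector for \<open>\<mu>\<close> is
    \<open>Re \<mu>\<close>, and \<open>m0\<close> is a lower bound for all these quotients.\<close>
  have lower: "m0 \<le> Re \<mu>" if "\<mu> \<in> spectrum (gram_mat)" for \<mu>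
  proof -
    from that G obtain v where v: "v \<in> carrier_vec n" "v \<noteq> 0\<^sub>v n" "gram_mat *\<^sub>v v = \<mu> \<cdot>\<^sub>v v"
      by (auto simp: spectrum_def eigenvalue_def eigenvector_def)
    have "(\<Sum>i<n. \<Sum>j<n. cnj (vec_index v i) * vec_index v j * k i j) = (\<Sum>i<n. cnj (vec_index v i) * (\<Sum>j<n. k i j * vec_index v j))"
      by (simp add: sum_distrib_left mult_ac)
    also have "\<dots> = (\<Sum>i<n. cnj (vec_index v i) * (\<mu> * vec_index v i))"
      using v by (intro sum.cong) (auto simp: gram_mat_mult_vec[symmetric])
    also have "\<dots> = \<mu> * of_real (?N (\<lambda>i. vec_index v i))"
      by (simp add: sum_distrib_left complex_norm_square mult_ac del: of_real_power)
    finally have "kernel_form k {..<n} (\<lambda>i. vec_index v i) = Re \<mu> * ?N (\<lambda>i. vec_index v i)"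
      by (simp add: kernel_form_def del: of_real_sum)
    moreover obtain i where "i < n" "vec_index v i \<noteq> 0"
      using v by (metis carrier_vecD eq_vecI index_zero_vec)
    then have "?N (\<lambda>i. vec_index v i) > 0" by (intro sum_pos2[of _ i]) auto
    ultimately show ?thesis using m0[of "\<lambda>i. vec_index v i"] by simp
  qed
  have "of_real m0 \<in> spectrum (gram_mat)"
  proof (rule ccontr)
    assume no: "of_real m0 \<notin> spectrum (gram_mat)"
    define H where "H = Matrix.mat n n (\<lambda>(i, j). k i j - (if i = j then of_real m0 else 0))"
    have H: "H \<in> carrier_mat n n" by (simp add: H_def)
    have Hv: "vec_index (H *\<^sub>v v) i = (\<Sum>j<n. (k i j - (if i = j then of_real m0 else 0)) * vec_index v j)"
      if "v \<in> carrier_vec n" "i < n" for v i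
      using that by (auto simp: H_def scalar_prod_def lessThan_atLeast0 intro!: sum.cong)
    have "Determinant.det H \<noteq> 0"
    proof
      assume "Determinant.det H = 0"
      then obtain v where v: "v \<in> carrier_vec n" "v \<noteq> 0\<^sub>v n" "H *\<^sub>v v = 0\<^sub>v n"
        using det_0_iff_vec_prod_zero_field[OF H] by blast
      have "gram_mat *\<^sub>v v = of_real m0 \<cdot>\<^sub>v v"
      proof (rule eq_vecI)
        fix i assume "i < dim_vec (complex_of_real m0 \<cdot>\<^sub>v v)"
        then have i: "i < n" using v by simp
        have "0 = (\<Sum>j<n. k i j * vec_index v j) - of_real m0 * vec_index v i"
          using Hv[OF v(1) i] v i
          by (simp add: left_diff_distrib sum_subtractf if_distrib[of "\<lambda>x. x * _"] cong: if_cong)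
        then show "vec_index (gram_mat *\<^sub>v v) i = vec_index (of_real m0 \<cdot>\<^sub>v v) i"
          using v i by (simp add: gram_mat_mult_vec)
      qed (use v G in auto)
      then show False using no v G by (auto simp: spectrum_def eigenvalue_def eigenvector_def)
    qed
    then obtain B where B: "B \<in> carrier_mat n n" "B * H = 1\<^sub>m n"
      using det_non_zero_imp_unit[OF H, where b = "()"] by (auto simp: Units_def ring_mat_simps)
    define h where "h i j = k i j - (if i = j then of_real m0 else 0)" for i j
    have form_h: "kernel_form h {..<n} v = kernel_form k {..<n} v - m0 * ?N v" for v
      using kernel_form_shift[of "{..<n}" k m0 v] by (simp add: h_def[abs_def])
    interpret shift: psd_kernel h n
    proof
      show "h j i = cnj (h i j)" for i j
        using hermitian[of j i] by (simp add: h_def)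
      show "0 \<le> kernel_form h {..<n} v" for v
        using m0[of v] by (simp add: form_h)
    qed
    define K where "K = (\<Sum>i<n. Re (h i i) + 1)"
    define \<beta> where "\<beta> = (\<Sum>i<n. \<Sum>j<n. cmod (B $$ (i, j)))"
    have diag: "Re (h i i) \<ge> 0" if "i < n" for i
      using shift.diag_nonneg[OF that] .
    have K: "Re (h i i) + 1 \<le> K" if "i < n" for i
      unfolding K_def using that diag by (intro member_le_sum) (auto simp: add_nonneg_nonneg)
    have K0: "K \<ge> 0" unfolding K_def using diag by (intro sum_nonneg) auto
    \<comment> \<open>Write w = H v, so that v = B w. By \<open>entry_le_form\<close> each entry of
      w is at most sqrt (K q) in modulus, where \<open>K\<close> dominates all factors
      \<open>Re (h i i) + 1\<close>; \<open>\<beta>\<close> dominates every row sum of B in modulus.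
      The final + 1 only makes the constant positive.\<close>
    have bound: "?N v \<le> (real n * \<beta>\<^sup>2 * K + 1) * kernel_form h {..<n} v" for v
    proof -
      define q where "q = kernel_form h {..<n} v"
      have q: "q \<ge> 0" unfolding q_def by (rule shift.nonneg)
      define w where "w i = (\<Sum>j<n. h i j * v j)" for i
      have w: "cmod (w i) \<le> sqrt (K * q)" if "i < n" for i
      proof (rule real_le_rsqrt)
        have "(cmod (w i))\<^sup>2 \<le> (Re (h i i) + 1) * q"
          using shift.entry_le_form[OF that, of v] by (simp add: w_def q_def)
        also have "\<dots> \<le> K * q" using K[OF that] q by (rule mult_right_mono)
        finally show "(cmod (w i))\<^sup>2 \<le> K * q" .
      qed
      have v: "v i = (\<Sum>j<n. B $$ (i, j) * w j)" if i: "i < n" for i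
      proof -
        have "Matrix.vec n v = (B * H) *\<^sub>v Matrix.vec n v" using B by simp
        also have "\<dots> = B *\<^sub>v (H *\<^sub>v Matrix.vec n v)"
          using B H by (intro assoc_mult_mat_vec) auto
        finally have "vec_index (Matrix.vec n v) i = vec_index (B *\<^sub>v (H *\<^sub>v Matrix.vec n v)) i"
          by (rule arg_cong)
        also have "\<dots> = (\<Sum>j<n. B $$ (i, j) * vec_index (H *\<^sub>v Matrix.vec n v) j)"
          using B H i by (auto simp: scalar_prod_def lessThan_atLeast0 intro!: sum.cong)
        also have "\<dots> = (\<Sum>j<n. B $$ (i, j) * w j)"
          using Hv[of "Matrix.vec n v"] by (intro sum.cong) (auto simp: w_def h_def)
        finally show ?thesis using i by simp
      qed
      have "cmod (v i) \<le> \<beta> * sqrt (K * q)" if i: "i < n" for i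
      proof -
        have "cmod (v i) \<le> (\<Sum>j<n. cmod (B $$ (i, j)) * cmod (w j))"
          unfolding v[OF i] norm_mult[symmetric] by (rule norm_sum)
        also have "\<dots> \<le> (\<Sum>j<n. cmod (B $$ (i, j)) * sqrt (K * q))"
          using w by (intro sum_mono mult_left_mono) auto
        also have "\<dots> = (\<Sum>j<n. cmod (B $$ (i, j))) * sqrt (K * q)"
          by (simp add: sum_distrib_right)
        also have "\<dots> \<le> \<beta> * sqrt (K * q)"
          unfolding \<beta>_def using i K0 q
          by (intro mult_right_mono member_le_sum) (auto intro: sum_nonneg)
        finally show ?thesis .
      qed
      then have "?N v \<le> (\<Sum>i<n. (\<beta> * sqrt (K * q))\<^sup>2)"
        by (intro sum_mono power_mono) auto
      also have "\<dots> = real n * \<beta>\<^sup>2 * K * q"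
        using K0 q by (simp add: power_mult_distrib)
      also have "\<dots> \<le> (real n * \<beta>\<^sup>2 * K + 1) * q" using q by (simp add: algebra_simps)
      finally show ?thesis by (simp add: q_def)
    qed
    define C where "C = real n * \<beta>\<^sup>2 * K + 1"
    have C: "C > 0" using K0 by (simp add: C_def add_nonneg_pos)
    \<comment> \<open>The coercivity of the shifted form by 1/C improves the lower bound
      \<open>m0\<close> of the original one, against the choice of \<open>m0\<close> as a
      supremum.\<close>
    have "m0 + 1 / C \<in> M"
      unfolding M_def
    proof (intro CollectI allI)
      fix v
      have "?N v \<le> C * (kernel_form k {..<n} v - m0 * ?N v)"
        using bound[of v] by (simp add: C_def form_h)
      then have "?N v / C \<le> kernel_form k {..<n} v - m0 * ?N v"
        using C by (simp add: pos_divide_le_eq mult.commute)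
      then show "(m0 + 1 / C) * ?N v \<le> kernel_form k {..<n} v"
        by (simp add: distrib_right)
    qed
    then have "m0 + 1 / C \<le> m0" unfolding m0_def by (rule cSup_upper[OF _ bdd])
    then show False using C by simp
  qed
  then have "m0 \<in> Re ` spectrum gram_mat" by force
  then have l: "l = m0"
    unfolding l_def using lower card_finite_spectrum(1)[OF G] by (intro Min_eqI) auto
  show "\<forall>v. l * (\<Sum>i<n. (cmod (v i))\<^sup>2) \<le> kernel_form k {..<n} v"
    using m0 l by simp
  show "m \<le> l" if "\<forall>v. m * (\<Sum>i<n. (cmod (v i))\<^sup>2) \<le> kernel_form k {..<n} v"
    unfolding l m0_def using that by (intro cSup_upper bdd) (simp add: M_def)
qed

end

section \<open>Lower bounds of quadratic forms and strong minimality\<close>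

lemma kernel_form_cong:
  "(\<And>i. i \<in> F \<Longrightarrow> v i = w i) \<Longrightarrow> kernel_form k F v = kernel_form k F w"
  unfolding kernel_form_def by (intro arg_cong[where f = Re] sum.cong refl) auto

lemma kernel_form_reindex:
  assumes "inj_on e F"
  shows "kernel_form k (e ` F) v = kernel_form (\<lambda>i j. k (e i) (e j)) F (v \<circ> e)"
  unfolding kernel_form_def sum.reindex[OF assms] o_def ..

lemma kernel_form_zero_extend:
  assumes "finite G" "F \<subseteq> G"
  shows "kernel_form k G (\<lambda>i. if i \<in> F then v i else 0) = kernel_form k F v"
proof -
  define w where "w i = (if i \<in> F then v i else 0)" for i
  have "(\<Sum>i\<in>G. \<Sum>j\<in>G. cnj (w i) * w j * k i j) = (\<Sum>i\<in>F. \<Sum>j\<in>F. cnj (w i) * w j * k i j)"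
    using assms by (intro sum.mono_neutral_cong_right) (auto simp: w_def intro!: sum.mono_neutral_right)
  also have "\<dots> = (\<Sum>i\<in>F. \<Sum>j\<in>F. cnj (v i) * v j * k i j)"
    by (intro sum.cong) (auto simp: w_def)
  finally show ?thesis by (simp add: kernel_form_def w_def)
qed

text \<open>For a Gram kernel, one positive \<open>m\<close> valid for all finite \<open>F\<close>
  is the lower Riesz-sequence inequality, while \<open>m = 0\<close> expresses positive
  semidefiniteness.\<close>

definition form_lower_bound :: "(nat \<Rightarrow> nat \<Rightarrow> complex) \<Rightarrow> nat set \<Rightarrow> real \<Rightarrow> bool" where
  "form_lower_bound k F m \<longleftrightarrow> (\<forall>v. m * (\<Sum>i\<in>F. (cmod (v i))\<^sup>2) \<le> kernel_form k F v)"

lemma form_lower_bound_subset: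
  assumes G: "form_lower_bound k G m" and FG: "finite G" "F \<subseteq> G"
  shows "form_lower_bound k F m"
  unfolding form_lower_bound_def
proof
  fix v :: "nat \<Rightarrow> complex"
  define w where "w i = (if i \<in> F then v i else 0)" for i
  have "(\<Sum>i\<in>G. (cmod (w i))\<^sup>2) = (\<Sum>i\<in>F. (cmod (v i))\<^sup>2)"
    using FG by (intro sum.mono_neutral_cong_right) (auto simp: w_def)
  moreover have "kernel_form k G w = kernel_form k F v"
    using kernel_form_zero_extend[OF FG, of k v] by (simp add: w_def[abs_def])
  moreover have "m * (\<Sum>i\<in>G. (cmod (w i))\<^sup>2) \<le> kernel_form k G w"
    using G by (simp add: form_lower_bound_def)
  ultimately show "m * (\<Sum>i\<in>F. (cmod (v i))\<^sup>2) \<le> kernel_form k F v" by simp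
qed

lemma form_lower_bound_reindex:
  assumes e: "inj_on e F"
  shows "form_lower_bound k (e ` F) m \<longleftrightarrow> form_lower_bound (\<lambda>i j. k (e i) (e j)) F m"
proof
  assume "form_lower_bound k (e ` F) m"
  then have *: "m * (\<Sum>i\<in>F. (cmod (v (e i)))\<^sup>2) \<le> kernel_form (\<lambda>i j. k (e i) (e j)) F (v \<circ> e)" for v
    unfolding form_lower_bound_def kernel_form_reindex[OF e] sum.reindex[OF e] by simp
  show "form_lower_bound (\<lambda>i j. k (e i) (e j)) F m"
    unfolding form_lower_bound_def
  proof
    fix v
    have "kernel_form (\<lambda>i j. k (e i) (e j)) F ((v \<circ> inv_into F e) \<circ> e)
        = kernel_form (\<lambda>i j. k (e i) (e j)) F v"
      by (rule kernel_form_cong) (simp add: e)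
    then show "m * (\<Sum>i\<in>F. (cmod (v i))\<^sup>2) \<le> kernel_form (\<lambda>i j. k (e i) (e j)) F v"
      using *[of "v \<circ> inv_into F e"] by (simp add: e)
  qed
next
  assume *: "form_lower_bound (\<lambda>i j. k (e i) (e j)) F m"
  show "form_lower_bound k (e ` F) m"
    unfolding form_lower_bound_def kernel_form_reindex[OF e] sum.reindex[OF e]
    using * by (auto simp: form_lower_bound_def o_def)
qed

text \<open>The least eigenvalue is the largest lower bound of the form, so matrices can be left
  behind from here on. A positive \<open>n\<close> is required because the empty matrix has no
  eigenvalue and \<open>Min\<close> of the empty set says nothing.\<close>

lemma least_gram_eigenvalue_lower_bound:
  assumes herm: "\<And>x y. ip y x = cnj (ip x y)"
    and nonneg: "form_lower_bound (\<lambda>i j. ip (x i) (x j)) {..<n} 0" and n: "n > 0"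
  shows "form_lower_bound (\<lambda>i j. ip (x i) (x j)) {..<n} m \<longleftrightarrow> m \<le> least_gram_eigenvalue ip x n"
proof -
  interpret psd_kernel "\<lambda>i j. ip (x i) (x j)" n
    using nonneg by unfold_locales (rule herm, simp add: form_lower_bound_def)
  define l where "l = least_gram_eigenvalue ip x n"
  have l: "l = Min (Re ` spectrum gram_mat)"
    by (simp add: l_def least_gram_eigenvalue_def gram_def gram_mat_def)
  show ?thesis
    unfolding l_def[symmetric]
  proof
    assume "form_lower_bound (\<lambda>i j. ip (x i) (x j)) {..<n} m"
    then show "m \<le> l"
      unfolding l form_lower_bound_def by (rule least_eigenvalue_gram_mat(2)[OF n])
  next
    assume m: "m \<le> l"
    show "form_lower_bound (\<lambda>i j. ip (x i) (x j)) {..<n} m"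
      unfolding form_lower_bound_def
    proof
      fix v
      have "m * (\<Sum>i<n. (cmod (v i))\<^sup>2) \<le> l * (\<Sum>i<n. (cmod (v i))\<^sup>2)"
        using m by (intro mult_right_mono sum_nonneg) auto
      also have "\<dots> \<le> kernel_form (\<lambda>i j. ip (x i) (x j)) {..<n} v"
        using least_eigenvalue_gram_mat(1)[OF n] unfolding l by blast
      finally show "m * (\<Sum>i<n. (cmod (v i))\<^sup>2) \<le> kernel_form (\<lambda>i j. ip (x i) (x j)) {..<n} v" .
    qed
  qed
qed

text \<open>Lower bounds pass to subsets, so the least eigenvalues decrease along the enumeration:
  they have a positive limit exactly when they have a common positive lower bound. Each finite
  subset of \<open>J\<close> lies in an initial segment, so such a bound serves all of them.\<close>

lemma strongly_minimal_iff:
  assumes herm: "\<And>x y. ip y x = cnj (ip x y)"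
    and nonneg: "\<And>F. finite F \<Longrightarrow> F \<subseteq> J \<Longrightarrow> form_lower_bound (\<lambda>i j. ip (f i) (f j)) F 0"
  shows "strongly_minimal ip f J \<longleftrightarrow>
    (\<exists>m>0. \<forall>F. finite F \<and> F \<subseteq> J \<longrightarrow> form_lower_bound (\<lambda>i j. ip (f i) (f j)) F m)"
    (is "_ \<longleftrightarrow> ?R")
proof -
  define \<kappa> where "\<kappa> i j = ip (f i) (f j)" for i j
  define e where "e = enumerate J"
  define l where "l n = least_gram_eigenvalue ip (f \<circ> e) n" for n
  have l: "form_lower_bound \<kappa> (e ` {..<n}) m \<longleftrightarrow> m \<le> l n"
    if "n > 0" "inj_on e {..<n}" "e ` {..<n} \<subseteq> J" for n m
  proof -
    have "form_lower_bound (\<lambda>i j. ip ((f \<circ> e) i) ((f \<circ> e) j)) {..<n} 0"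
      using form_lower_bound_reindex[OF that(2), of \<kappa> 0] nonneg[OF _ that(3)]
      by (simp add: \<kappa>_def[abs_def])
    from least_gram_eigenvalue_lower_bound[where ip = ip and x = "f \<circ> e", OF herm this that(1)]
    show ?thesis
      using form_lower_bound_reindex[OF that(2), of \<kappa>] by (simp add: \<kappa>_def[abs_def] l_def)
  qed
  show ?thesis
  proof (cases "finite J")
    case True
    show ?thesis
    proof (cases "J = {}")
      case True
      then have "?R" by (intro exI[of _ 1]) (auto simp: form_lower_bound_def kernel_form_def)
      then show ?thesis using True by (simp add: strongly_minimal_def)
    next
      case False
      have bij: "bij_betw e {..<card J} J"
        unfolding e_def by (rule finite_bij_enumerate[OF True])
      have card: "card J > 0" using True False by (simp add: card_gt_0_iff)
      have lJ: "form_lower_bound \<kappa> J m \<longleftrightarrow> m \<le> l (card J)" for m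
        using l[OF card, of m] bij by (simp add: bij_betw_def)
      have "?R \<longleftrightarrow> (\<exists>m>0. form_lower_bound \<kappa> J m)"
        unfolding \<kappa>_def[symmetric] using form_lower_bound_subset True by blast
      also have "\<dots> \<longleftrightarrow> 0 < l (card J)"
        unfolding lJ by (metis less_le_trans order_refl)
      finally show ?thesis
        using True False by (simp add: strongly_minimal_def l_def e_def)
    qed
  next
    case inf: False
    have inj: "inj_on e {..<n}" for n
      using inj_enumerate[OF inf] inj_on_subset unfolding e_def by blast
    have sub: "e ` {..<n} \<subseteq> J" for n
      unfolding e_def using range_enumerate[OF inf] by blast
    \<comment> \<open>The index starts at \<open>Suc n\<close> to skip the eigenvalue of the empty
      Gram matrix, an arbitrary value that could spoil monotonicity but does not affect the
      limit.\<close>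
    have lS: "form_lower_bound \<kappa> (e ` {..<Suc n}) m \<longleftrightarrow> m \<le> l (Suc n)" for n m
      using l[OF _ inj sub, of "Suc n" m] by simp
    have "decseq (\<lambda>n. l (Suc n))"
    proof (rule decseq_SucI)
      fix n
      have "form_lower_bound \<kappa> (e ` {..<Suc (Suc n)}) (l (Suc (Suc n)))" by (simp only: lS)
      then have "form_lower_bound \<kappa> (e ` {..<Suc n}) (l (Suc (Suc n)))"
        by (rule form_lower_bound_subset) auto
      then show "l (Suc (Suc n)) \<le> l (Suc n)" by (simp only: lS)
    qed
    have "?R \<longleftrightarrow> (\<exists>m>0. \<forall>n. form_lower_bound \<kappa> (e ` {..<Suc n}) m)"
    proof -
      have "\<exists>n. F \<subseteq> e ` {..<Suc n}" if F: "finite F" "F \<subseteq> J" for F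
      proof -
        have "F \<subseteq> range e" using F range_enumerate[OF inf] by (simp add: e_def)
        then obtain C where C: "finite C" "F = e ` C"
          using finite_subset_image[OF F(1)] by blast
        then obtain n where "C \<subseteq> {..<n}" by (metis finite_nat_iff_bounded)
        then show ?thesis using C by (intro exI[of _ n]) force
      qed
      then show ?thesis
        unfolding \<kappa>_def[symmetric]
        by (meson finite_imageI finite_lessThan form_lower_bound_subset sub)
    qed
    also have "\<dots> \<longleftrightarrow> (\<exists>m>0. \<forall>n. m \<le> l (Suc n))" by (simp only: lS)
    also have "\<dots> \<longleftrightarrow> (\<exists>L>0. l \<longlonglongrightarrow> L)"
    proof
      assume "\<exists>m>0. \<forall>n. m \<le> l (Suc n)"
      then obtain m where m: "m > 0" "\<And>n. m \<le> l (Suc n)" by blast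
      obtain L where "(\<lambda>n. l (Suc n)) \<longlonglongrightarrow> L" "\<forall>n. L \<le> l (Suc n)"
        using decseq_convergent[OF \<open>decseq _\<close>, of m] m(2) by blast
      moreover then have "m \<le> L" using m(2) by (intro LIMSEQ_le_const) auto
      ultimately show "\<exists>L>0. l \<longlonglongrightarrow> L"
        using m(1) by (intro exI[of _ L]) (simp add: LIMSEQ_imp_Suc)
    next
      assume "\<exists>L>0. l \<longlonglongrightarrow> L"
      then obtain L where "L > 0" "l \<longlonglongrightarrow> L" by blast
      then show "\<exists>m>0. \<forall>n. m \<le> l (Suc n)"
        using decseq_ge[OF \<open>decseq _\<close> LIMSEQ_Suc] by blast
    qed
    finally show ?thesis
      using inf by (auto simp: strongly_minimal_def l_def[abs_def] e_def)
  qed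
qed

section \<open>Square-integrable functions\<close>

definition L2_sq :: "real \<Rightarrow> (real \<Rightarrow> complex) \<Rightarrow> real" where
  "L2_sq T u = (LINT t|lebesgue_on {0..T}. (cmod (u t))\<^sup>2)"

lemma L2_inner_self: "L2_inner T u u = of_real (L2_sq T u)"
  unfolding L2_inner_def L2_sq_def integral_complex_of_real[symmetric]
  by (simp add: complex_norm_square del: of_real_power)

lemma L2_sq_nonneg: "L2_sq T u \<ge> 0"
  unfolding L2_sq_def by (intro Bochner_Integration.integral_nonneg) auto

lemma L2_inner_commute: "L2_inner T v u = cnj (L2_inner T u v)"
proof -
  have "cnj (L2_inner T u v) = (LINT t|lebesgue_on {0..T}. cnj (u t * cnj (v t)))"
    unfolding L2_inner_def by (rule Bochner_Integration.integral_cnj[symmetric])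
  then show ?thesis by (simp add: L2_inner_def mult.commute)
qed

lemma L2_fun_measurable: "L2_fun T u \<Longrightarrow> u \<in> borel_measurable (lebesgue_on {0..T})"
  by (simp add: L2_fun_def)

lemma L2_fun_integrable_sq: "L2_fun T u \<Longrightarrow> integrable (lebesgue_on {0..T}) (\<lambda>t. (cmod (u t))\<^sup>2)"
  by (simp add: L2_fun_def)

lemma L2_fun_integrable_mult:
  assumes u: "L2_fun T u" and v: "L2_fun T v"
  shows "integrable (lebesgue_on {0..T}) (\<lambda>t. u t * v t)"
proof (rule Bochner_Integration.integrable_bound)
  show "integrable (lebesgue_on {0..T}) (\<lambda>t. (cmod (u t))\<^sup>2 + (cmod (v t))\<^sup>2)"
    using u v by (intro Bochner_Integration.integrable_add L2_fun_integrable_sq)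
  show "(\<lambda>t. u t * v t) \<in> borel_measurable (lebesgue_on {0..T})"
    using u v by (intro borel_measurable_times L2_fun_measurable)
  have "cmod (u t * v t) \<le> (cmod (u t))\<^sup>2 + (cmod (v t))\<^sup>2" for t
  proof -
    have "2 * (cmod (u t) * cmod (v t)) \<le> (cmod (u t))\<^sup>2 + (cmod (v t))\<^sup>2"
      using sum_squares_bound[of "cmod (u t)" "cmod (v t)"] by (simp only: mult.assoc)
    moreover have "0 \<le> cmod (u t) * cmod (v t)" by simp
    ultimately show ?thesis unfolding norm_mult by linarith
  qed
  then show "AE t in lebesgue_on {0..T}. norm (u t * v t) \<le> norm ((cmod (u t))\<^sup>2 + (cmod (v t))\<^sup>2)"
    by (simp add: abs_of_nonneg)
qed

lemma L2_fun_cnj: "L2_fun T u \<Longrightarrow> L2_fun T (\<lambda>t. cnj (u t))"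
proof -
  have "cnj \<in> borel_measurable borel"
    by (intro borel_measurable_continuous_onI continuous_intros)
  then show "L2_fun T u \<Longrightarrow> L2_fun T (\<lambda>t. cnj (u t))"
    using measurable_compose[OF L2_fun_measurable] by (simp add: L2_fun_def)
qed

lemma L2_fun_integrable_inner:
  "L2_fun T u \<Longrightarrow> L2_fun T v \<Longrightarrow> integrable (lebesgue_on {0..T}) (\<lambda>t. u t * cnj (v t))"
  by (intro L2_fun_integrable_mult L2_fun_cnj)

lemma L2_fun_scale: "L2_fun T u \<Longrightarrow> L2_fun T (\<lambda>t. c * u t)"
  by (auto simp: L2_fun_def norm_mult power_mult_distrib)

lemma L2_fun_zero: "L2_fun T (\<lambda>t. 0)"
  by (simp add: L2_fun_def)

lemma cmod_add_sq_le: "(cmod (x + y))\<^sup>2 \<le> 2 * (cmod x)\<^sup>2 + 2 * (cmod y)\<^sup>2"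
proof -
  have "(cmod (x + y))\<^sup>2 \<le> (cmod x + cmod y)\<^sup>2"
    by (intro power_mono norm_triangle_ineq) auto
  then show ?thesis using sum_squares_bound[of "cmod x" "cmod y"] by (simp add: power2_sum)
qed

lemma L2_fun_add:
  assumes u: "L2_fun T u" and v: "L2_fun T v"
  shows "L2_fun T (\<lambda>t. u t + v t)"
  unfolding L2_fun_def
proof
  show m: "(\<lambda>t. u t + v t) \<in> borel_measurable (lebesgue_on {0..T})"
    using u v by (intro borel_measurable_add L2_fun_measurable)
  show "integrable (lebesgue_on {0..T}) (\<lambda>t. (cmod (u t + v t))\<^sup>2)"
  proof (rule Bochner_Integration.integrable_bound)
    show "integrable (lebesgue_on {0..T}) (\<lambda>t. 2 * (cmod (u t))\<^sup>2 + 2 * (cmod (v t))\<^sup>2)"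
      using u v by (intro Bochner_Integration.integrable_add integrable_mult_right L2_fun_integrable_sq)
    show "(\<lambda>t. (cmod (u t + v t))\<^sup>2) \<in> borel_measurable (lebesgue_on {0..T})"
      using m by measurable
    show "AE t in lebesgue_on {0..T}. norm ((cmod (u t + v t))\<^sup>2) \<le> norm (2 * (cmod (u t))\<^sup>2 + 2 * (cmod (v t))\<^sup>2)"
      using cmod_add_sq_le by (simp add: abs_of_nonneg)
  qed
qed

lemma L2_fun_diff: "L2_fun T u \<Longrightarrow> L2_fun T v \<Longrightarrow> L2_fun T (\<lambda>t. u t - v t)"
  using L2_fun_add[of T u "\<lambda>t. - 1 * v t"] L2_fun_scale[of T v "- 1"] by simp

lemma L2_fun_sum: "(\<And>i. i \<in> F \<Longrightarrow> L2_fun T (u i)) \<Longrightarrow> L2_fun T (\<lambda>t. \<Sum>i\<in>F. u i t)"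
  by (induction F rule: infinite_finite_induct) (auto simp: L2_fun_zero intro: L2_fun_add)

lemma L2_fun_continuous:
  assumes "continuous_on {0..T} u"
  shows "L2_fun T u"
  unfolding L2_fun_def
proof
  show "u \<in> borel_measurable (lebesgue_on {0..T})"
    using assms by (rule continuous_imp_measurable_on_sets_lebesgue) auto
  show "integrable (lebesgue_on {0..T}) (\<lambda>t. (cmod (u t))\<^sup>2)"
    using assms by (intro continuous_imp_integrable_real continuous_intros)
qed

lemma L2_inner_add_left:
  "L2_fun T u \<Longrightarrow> L2_fun T v \<Longrightarrow> L2_fun T w \<Longrightarrow>
    L2_inner T (\<lambda>t. u t + v t) w = L2_inner T u w + L2_inner T v w"
  unfolding L2_inner_def
  by (simp add: distrib_right Bochner_Integration.integral_add L2_fun_integrable_inner)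

lemma L2_inner_diff_left:
  "L2_fun T u \<Longrightarrow> L2_fun T v \<Longrightarrow> L2_fun T w \<Longrightarrow>
    L2_inner T (\<lambda>t. u t - v t) w = L2_inner T u w - L2_inner T v w"
  unfolding L2_inner_def
  by (simp add: left_diff_distrib Bochner_Integration.integral_diff L2_fun_integrable_inner)

lemma L2_inner_scale_left: "L2_inner T (\<lambda>t. c * u t) w = c * L2_inner T u w"
  unfolding L2_inner_def by (simp add: mult.assoc)

lemma L2_inner_scale_right: "L2_inner T w (\<lambda>t. c * u t) = cnj c * L2_inner T w u"
  by (subst (1 2) L2_inner_commute) (simp add: L2_inner_scale_left)

lemma L2_inner_add_right:
  "L2_fun T u \<Longrightarrow> L2_fun T v \<Longrightarrow> L2_fun T w \<Longrightarrow>
    L2_inner T w (\<lambda>t. u t + v t) = L2_inner T w u + L2_inner T w v"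
  by (subst (1 2 3) L2_inner_commute) (simp add: L2_inner_add_left)

lemma L2_inner_sum_left:
  assumes "\<And>i. i \<in> F \<Longrightarrow> L2_fun T (u i)" "L2_fun T w"
  shows "L2_inner T (\<lambda>t. \<Sum>i\<in>F. u i t) w = (\<Sum>i\<in>F. L2_inner T (u i) w)"
  unfolding L2_inner_def sum_distrib_right
proof (rule Bochner_Integration.integral_sum)
  fix i assume "i \<in> F"
  then show "integrable (lebesgue_on {0..T}) (\<lambda>t. u i t * cnj (w t))"
    by (rule L2_fun_integrable_inner[OF assms(1) assms(2)])
qed

lemma L2_inner_sum_right:
  assumes "\<And>i. i \<in> F \<Longrightarrow> L2_fun T (u i)" "L2_fun T w"
  shows "L2_inner T w (\<lambda>t. \<Sum>i\<in>F. u i t) = (\<Sum>i\<in>F. L2_inner T w (u i))"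
proof -
  have "L2_inner T w (\<lambda>t. \<Sum>i\<in>F. u i t) = cnj (L2_inner T (\<lambda>t. \<Sum>i\<in>F. u i t) w)"
    by (rule L2_inner_commute)
  also have "\<dots> = (\<Sum>i\<in>F. cnj (L2_inner T (u i) w))"
    by (simp only: L2_inner_sum_left[OF assms] cnj_sum)
  also have "\<dots> = (\<Sum>i\<in>F. L2_inner T w (u i))"
    by (rule sum.cong[OF refl L2_inner_commute[symmetric]])
  finally show ?thesis .
qed

lemma L2_sq_scale: "L2_sq T (\<lambda>t. c * u t) = (cmod c)\<^sup>2 * L2_sq T u"
  by (simp add: L2_sq_def norm_mult power_mult_distrib)

lemma L2_sq_add_scale:
  assumes "L2_fun T u" "L2_fun T v"
  shows "L2_sq T (\<lambda>t. u t + c * v t) = L2_sq T u + 2 * Re (cnj c * L2_inner T u v) + (cmod c)\<^sup>2 * L2_sq T v"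
proof -
  define z where "z = L2_inner T u v"
  have cv: "L2_fun T (\<lambda>t. c * v t)" using assms(2) by (rule L2_fun_scale)
  have vu: "L2_inner T v u = cnj z" unfolding z_def by (rule L2_inner_commute)
  have "complex_of_real (L2_sq T (\<lambda>t. u t + c * v t)) =
      L2_inner T u u + cnj c * z + (c * cnj z + c * (cnj c * L2_inner T v v))"
    unfolding L2_inner_self[symmetric]
    using L2_inner_add_left[OF assms(1) cv L2_fun_add[OF assms(1) cv]]
      L2_inner_add_right[OF assms(1) cv assms(1)] L2_inner_add_right[OF assms(1) cv cv]
    by (simp add: L2_inner_scale_left L2_inner_scale_right vu z_def)
  then have "L2_sq T (\<lambda>t. u t + c * v t)
      = Re (of_real (L2_sq T u) + cnj c * z + (c * cnj z + c * (cnj c * of_real (L2_sq T v))))"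
    unfolding L2_inner_self by (metis Re_complex_of_real)
  also have "c * (cnj c * of_real (L2_sq T v)) = of_real ((cmod c)\<^sup>2 * L2_sq T v)"
    by (simp only: of_real_mult complex_norm_square mult.assoc)
  finally have "L2_sq T (\<lambda>t. u t + c * v t) =
      L2_sq T u + Re (cnj c * z) + (Re (c * cnj z) + (cmod c)\<^sup>2 * L2_sq T v)"
    by (simp only: plus_complex.sel Re_complex_of_real)
  moreover have "Re (c * cnj z) = Re (cnj c * z)" by simp
  ultimately show ?thesis unfolding z_def by linarith
qed

lemma L2_inner_abs_le:
  assumes "L2_fun T u" "L2_fun T v"
  shows "(cmod (L2_inner T u v))\<^sup>2 \<le> L2_sq T u * L2_sq T v"
proof -
  define z where "z = L2_inner T u v"
  have quad: "0 \<le> L2_sq T u - 2 * r * (cmod z)\<^sup>2 + r\<^sup>2 * (cmod z)\<^sup>2 * L2_sq T v" for r :: real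
  proof -
    have "0 \<le> L2_sq T (\<lambda>t. u t + (- of_real r * z) * v t)" by (rule L2_sq_nonneg)
    also have "\<dots> = L2_sq T u + 2 * Re (cnj (- of_real r * z) * z) + (cmod (- of_real r * z))\<^sup>2 * L2_sq T v"
      using L2_sq_add_scale[OF assms, of "- of_real r * z"] by (simp only: z_def)
    also have "Re (cnj (- of_real r * z) * z) = - r * (cmod z)\<^sup>2"
      unfolding cmod_power2 by (simp add: power2_eq_square algebra_simps)
    also have "(cmod (- of_real r * z))\<^sup>2 = r\<^sup>2 * (cmod z)\<^sup>2"
      by (simp add: norm_mult power_mult_distrib)
    finally show ?thesis by simp
  qed
  show ?thesis
  proof (cases "L2_sq T v = 0")
    case True
    \<comment> \<open>A function of seminorm 0 need not be zero. Instead, the quadratic inequality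
      without its last term fails for large r unless z = 0; the chosen r makes its right side
      negative.\<close>
    show ?thesis
    proof (cases "z = 0")
      case False
      define r where "r = (L2_sq T u + 1) / (cmod z)\<^sup>2"
      have "r * (cmod z)\<^sup>2 = L2_sq T u + 1" using False by (simp add: r_def)
      moreover have "0 \<le> L2_sq T u - 2 * (r * (cmod z)\<^sup>2)" using quad[of r] True by simp
      ultimately show ?thesis using L2_sq_nonneg[of T u] by simp
    qed (simp add: z_def True)
  next
    case False
    then have pos: "L2_sq T v > 0" using L2_sq_nonneg[of T v] by simp
    define r where "r = 1 / L2_sq T v"
    have "r\<^sup>2 * (cmod z)\<^sup>2 * L2_sq T v = r * (cmod z)\<^sup>2"
      using pos by (simp add: r_def power2_eq_square[of "1 / _"])
    then have "r * (cmod z)\<^sup>2 \<le> L2_sq T u" using quad[of r] by linarith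
    then show ?thesis using pos by (simp add: z_def r_def pos_divide_le_eq)
  qed
qed

lemma L2_sq_add_le:
  assumes "L2_fun T u" "L2_fun T v"
  shows "L2_sq T (\<lambda>t. u t + v t) \<le> 2 * L2_sq T u + 2 * L2_sq T v"
proof -
  have "L2_sq T (\<lambda>t. u t + v t) \<le> (LINT t|lebesgue_on {0..T}. 2 * (cmod (u t))\<^sup>2 + 2 * (cmod (v t))\<^sup>2)"
    unfolding L2_sq_def using assms L2_fun_add[OF assms] cmod_add_sq_le
    by (intro integral_mono Bochner_Integration.integrable_add integrable_mult_right L2_fun_integrable_sq) auto
  also have "\<dots> = 2 * L2_sq T u + 2 * L2_sq T v"
    unfolding L2_sq_def using assms by (simp add: L2_fun_integrable_sq)
  finally show ?thesis .
qed

section \<open>Completeness and Riesz representation in L2\<close>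

lemma AE_summable_norm:
  fixes f :: "nat \<Rightarrow> 'a \<Rightarrow> complex"
  assumes int: "\<And>i. integrable M (f i)" and sum: "summable (\<lambda>i. LINT x|M. norm (f i x))"
  shows "AE x in M. summable (\<lambda>i. norm (f i x))"
proof -
  have [measurable]: "f i \<in> borel_measurable M" for i using int by auto
  have "(\<integral>\<^sup>+x. (\<Sum>i. ennreal (norm (f i x))) \<partial>M) = (\<Sum>i. \<integral>\<^sup>+x. ennreal (norm (f i x)) \<partial>M)"
    by (rule nn_integral_suminf) measurable
  also have "\<dots> = (\<Sum>i. ennreal (LINT x|M. norm (f i x)))"
    using int by (intro suminf_cong nn_integral_eq_integral) auto
  also have "\<dots> \<noteq> \<infinity>"
    by (subst suminf_ennreal2[OF _ sum]) simp_all
  finally have "AE x in M. (\<Sum>i. ennreal (norm (f i x))) \<noteq> \<infinity>"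
    by (intro nn_integral_noteq_infinite) measurable
  then show ?thesis
    by eventually_elim (rule summable_suminf_not_top; simp)
qed

text \<open>Riesz-Fischer for a rapidly Cauchy sequence. The geometric rate makes the increments
  summable in L1 of the bounded interval, hence almost everywhere; Fatou's lemma then turns the
  pointwise limit into a limit in L2.\<close>

lemma L2_complete:
  assumes u: "\<And>n. L2_fun T (u n)"
    and step: "\<And>n. L2_sq T (\<lambda>t. u (Suc n) t - u n t) \<le> (1/4) ^ n"
  shows "\<exists>v. L2_fun T v \<and> (\<lambda>n. L2_sq T (\<lambda>t. v t - u n t)) \<longlonglongrightarrow> 0"
proof -
  define M where "M = lebesgue_on {0..T}"
  have [measurable]: "u n \<in> borel_measurable M" for n
    using L2_fun_measurable[OF u] by (simp add: M_def)
  define d where "d n t = u (Suc n) t - u n t" for n t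
  have d: "L2_fun T (d n)" for n unfolding d_def by (intro L2_fun_diff u)
  have d_int: "integrable M (d n)" for n
  proof -
    have "L2_fun T (\<lambda>_. 1)" by (intro L2_fun_continuous continuous_on_const)
    from L2_fun_integrable_mult[OF d[of n] this] show ?thesis by (simp add: M_def)
  qed
  have const_int: "integrable M (\<lambda>_. c)" for c :: real
    unfolding M_def by (intro continuous_imp_integrable_real continuous_on_const)
  define C where "C = (LINT t|M. 1 :: real)"
  \<comment> \<open>Integrates the inequality 2x \<le> 2^n x^2 + 2^(-n), whose weight balances the
    squared distance 4^(-n) against the measure \<open>C\<close> of the interval.\<close>
  have norm_d: "(LINT t|M. cmod (d n t)) \<le> (1/2) ^ n * (1 + C)" for n
  proof -
    have "(LINT t|M. cmod (d n t)) \<le> (LINT t|M. 2 ^ n * (cmod (d n t))\<^sup>2 + (1/2) ^ n * 1)"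
    proof (rule integral_mono)
      show "integrable M (\<lambda>t. 2 ^ n * (cmod (d n t))\<^sup>2 + (1/2) ^ n * 1)"
        using L2_fun_integrable_sq[OF d[of n]] const_int
        by (intro Bochner_Integration.integrable_add integrable_mult_right) (auto simp: M_def)
      fix t
      define x where "x = cmod (d n t)"
      have "0 \<le> (2 ^ n * x - 1)\<^sup>2" by simp
      then have "2 ^ n * (2 * x) \<le> 2 ^ n * (2 ^ n * x\<^sup>2 + (1/2) ^ n)"
        by (simp add: power2_eq_square algebra_simps power_one_over)
      then have "2 * x \<le> 2 ^ n * x\<^sup>2 + (1/2) ^ n" by (rule mult_left_le_imp_le) simp
      then show "cmod (d n t) \<le> 2 ^ n * (cmod (d n t))\<^sup>2 + (1/2) ^ n * 1"
        unfolding x_def[symmetric] using norm_ge_zero[of "d n t"] x_def by linarith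
    qed (use d_int in auto)
    also have "\<dots> = 2 ^ n * L2_sq T (d n) + (1/2) ^ n * C"
      using L2_fun_integrable_sq[OF d[of n]] const_int
      by (subst Bochner_Integration.integral_add) (auto simp: M_def L2_sq_def C_def)
    also have "\<dots> \<le> 2 ^ n * (1/4) ^ n + (1/2) ^ n * C"
      using step[of n] by (intro add_mono mult_left_mono) (auto simp: d_def[abs_def])
    also have "2 ^ n * (1/4) ^ n = ((1/2) ^ n :: real)"
      by (simp add: power_mult_distrib[symmetric])
    finally show ?thesis by (simp add: algebra_simps)
  qed
  have "AE t in M. summable (\<lambda>n. cmod (d n t))"
  proof (rule AE_summable_norm[OF d_int])
    show "summable (\<lambda>n. LINT t|M. cmod (d n t))"
    proof (rule summable_comparison_test')
      show "summable (\<lambda>n. (1/2) ^ n * (1 + C))" by (intro summable_mult2 summable_geometric) simp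
      show "norm (LINT t|M. cmod (d n t)) \<le> (1/2) ^ n * (1 + C)" if "n \<ge> 0" for n
        using norm_d[of n] by (simp add: abs_of_nonneg)
    qed
  qed
  \<comment> \<open>\<open>lim\<close> gives a measurable function at once; its values on the null
    set of divergence are irrelevant.\<close>
  define v where "v t = lim (\<lambda>n. u n t)" for t
  have v_meas [measurable]: "v \<in> borel_measurable M" unfolding v_def[abs_def] by measurable
  have lim: "AE t in M. (\<lambda>n. u n t) \<longlonglongrightarrow> v t"
    using \<open>AE t in M. summable _\<close>
  proof eventually_elim
    fix t assume "summable (\<lambda>n. cmod (d n t))"
    then have "(\<lambda>n. \<Sum>k<n. d k t) \<longlonglongrightarrow> (\<Sum>k. d k t)"
      by (rule summable_LIMSEQ[OF summable_norm_cancel])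
    then have "(\<lambda>n. u 0 t + (\<Sum>k<n. d k t)) \<longlonglongrightarrow> u 0 t + (\<Sum>k. d k t)"
      by (rule tendsto_add[OF tendsto_const])
    also have "(\<lambda>n. u 0 t + (\<Sum>k<n. d k t)) = (\<lambda>n. u n t)"
      using sum_lessThan_telescope[of "\<lambda>k. u k t"] by (simp add: d_def)
    finally show "(\<lambda>n. u n t) \<longlonglongrightarrow> v t"
      unfolding v_def by (metis convergent_LIMSEQ_iff convergent_def)
  qed
  \<comment> \<open>The constant 4 reproduces itself under the factor 2 of
    \<open>L2_sq_add_le\<close>: 2 * (4 * 1/4) + 2 = 4.\<close>
  have tail: "L2_sq T (\<lambda>t. u (n + k) t - u n t) \<le> 4 * (1/4) ^ n" for n k
  proof (induction k arbitrary: n)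
    case 0
    then show ?case by (simp add: L2_sq_def)
  next
    case (Suc k)
    have "(\<lambda>t. u (n + Suc k) t - u n t) = (\<lambda>t. (u (Suc n + k) t - u (Suc n) t) + d n t)"
      by (simp add: d_def)
    then have "L2_sq T (\<lambda>t. u (n + Suc k) t - u n t)
        \<le> 2 * L2_sq T (\<lambda>t. u (Suc n + k) t - u (Suc n) t) + 2 * L2_sq T (d n)"
      using L2_sq_add_le[OF L2_fun_diff[OF u u] d] by presburger
    also have "\<dots> \<le> 2 * (4 * (1/4) ^ Suc n) + 2 * (1/4) ^ n"
      using Suc.IH[of "Suc n"] step[of n] by (intro add_mono mult_left_mono) (auto simp: d_def[abs_def])
    finally show ?case by simp
  qed
  have fatou: "(\<integral>\<^sup>+t. ennreal ((cmod (v t - u n t))\<^sup>2) \<partial>M) \<le> ennreal (4 * (1/4) ^ n)" for n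
  proof -
    have "AE t in M. ennreal ((cmod (v t - u n t))\<^sup>2) = liminf (\<lambda>m. ennreal ((cmod (u m t - u n t))\<^sup>2))"
      using lim
    proof eventually_elim
      fix t assume "(\<lambda>n. u n t) \<longlonglongrightarrow> v t"
      then have "(\<lambda>m. ennreal ((cmod (u m t - u n t))\<^sup>2)) \<longlonglongrightarrow> ennreal ((cmod (v t - u n t))\<^sup>2)"
        by (intro tendsto_intros tendsto_ennrealI)
      then show "ennreal ((cmod (v t - u n t))\<^sup>2) = liminf (\<lambda>m. ennreal ((cmod (u m t - u n t))\<^sup>2))"
        by (rule lim_imp_Liminf[OF sequentially_bot, symmetric])
    qed
    then have "(\<integral>\<^sup>+t. ennreal ((cmod (v t - u n t))\<^sup>2) \<partial>M)
        = (\<integral>\<^sup>+t. liminf (\<lambda>m. ennreal ((cmod (u m t - u n t))\<^sup>2)) \<partial>M)"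
      by (rule nn_integral_cong_AE)
    also have "\<dots> \<le> liminf (\<lambda>m. \<integral>\<^sup>+t. ennreal ((cmod (u m t - u n t))\<^sup>2) \<partial>M)"
      by (rule nn_integral_liminf) measurable
    also have "\<dots> \<le> ennreal (4 * (1/4) ^ n)"
    proof (rule Liminf_le[OF sequentially_bot])
      show "\<forall>\<^sub>F m in sequentially. (\<integral>\<^sup>+t. ennreal ((cmod (u m t - u n t))\<^sup>2) \<partial>M) \<le> ennreal (4 * (1/4) ^ n)"
        unfolding eventually_sequentially
      proof (intro exI[of _ n] allI impI)
        fix m assume "n \<le> m"
        have "(\<integral>\<^sup>+t. ennreal ((cmod (u m t - u n t))\<^sup>2) \<partial>M) = ennreal (L2_sq T (\<lambda>t. u m t - u n t))"
          unfolding L2_sq_def M_def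
          by (intro nn_integral_eq_integral L2_fun_integrable_sq L2_fun_diff u) auto
        also have "\<dots> \<le> ennreal (4 * (1/4) ^ n)"
          using tail[of n "m - n"] \<open>n \<le> m\<close> by (intro ennreal_leI) simp
        finally show "(\<integral>\<^sup>+t. ennreal ((cmod (u m t - u n t))\<^sup>2) \<partial>M) \<le> ennreal (4 * (1/4) ^ n)" .
      qed
    qed
    finally show ?thesis .
  qed
  have vu: "L2_fun T (\<lambda>t. v t - u n t)" for n
    unfolding L2_fun_def M_def[symmetric]
  proof
    show "integrable M (\<lambda>t. (cmod (v t - u n t))\<^sup>2)"
    proof (rule integrableI_bounded)
      show "(\<integral>\<^sup>+t. ennreal (norm ((cmod (v t - u n t))\<^sup>2)) \<partial>M) < \<infinity>"
        using fatou[of n] by (simp add: le_less_trans)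
    qed measurable
  qed measurable
  have le: "L2_sq T (\<lambda>t. v t - u n t) \<le> 4 * (1/4) ^ n" for n
  proof -
    have "ennreal (L2_sq T (\<lambda>t. v t - u n t)) = (\<integral>\<^sup>+t. ennreal ((cmod (v t - u n t))\<^sup>2) \<partial>M)"
      unfolding L2_sq_def M_def
      by (intro nn_integral_eq_integral[symmetric] L2_fun_integrable_sq vu) auto
    then have "ennreal (L2_sq T (\<lambda>t. v t - u n t)) \<le> ennreal (4 * (1/4) ^ n)"
      using fatou[of n] by (simp only:)
    then show ?thesis by (subst (asm) ennreal_le_iff) auto
  qed
  have lim0: "(\<lambda>n. 4 * (1/4) ^ n :: real) \<longlonglongrightarrow> 0"
    using tendsto_mult_right_zero[OF LIMSEQ_power_zero[of "1/4 :: real"]] by simp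
  have "(\<lambda>n. L2_sq T (\<lambda>t. v t - u n t)) \<longlonglongrightarrow> 0"
  proof (rule tendsto_sandwich[OF _ _ tendsto_const lim0])
    show "\<forall>\<^sub>F n in sequentially. 0 \<le> L2_sq T (\<lambda>t. v t - u n t)"
      by (rule always_eventually) (simp add: L2_sq_nonneg)
    show "\<forall>\<^sub>F n in sequentially. L2_sq T (\<lambda>t. v t - u n t) \<le> 4 * (1/4) ^ n"
      by (rule always_eventually) (simp only: le simp_thms)
  qed
  moreover have "L2_fun T v"
    using L2_fun_add[OF vu[of 0] u[of 0]] by simp
  ultimately show ?thesis by blast
qed

text \<open>
  \<open>S\<close> is the graph of a bounded antilinear functional on a subspace. The representing function is
  the limit of a minimizing sequence of \<open>w \<mapsto> \<parallel>w\<parallel>\<^sup>2 - 2 Re l\<close>, so no closure or projection is needed.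
\<close>

lemma L2_riesz:
  fixes S :: "(real \<Rightarrow> complex) \<Rightarrow> complex \<Rightarrow> bool"
  assumes L2: "\<And>w l. S w l \<Longrightarrow> L2_fun T w"
    and comb: "\<And>w l w' l' c. S w l \<Longrightarrow> S w' l' \<Longrightarrow> S (\<lambda>t. w t + c * w' t) (l + cnj c * l')"
    and zero: "S (\<lambda>t. 0) 0"
    and B: "B \<ge> 0" and bound: "\<And>w l. S w l \<Longrightarrow> (cmod l)\<^sup>2 \<le> B * L2_sq T w"
  shows "\<exists>u. L2_fun T u \<and> (\<forall>w l. S w l \<longrightarrow> L2_inner T u w = l)"
proof -
  define \<Phi> where "\<Phi> w l = L2_sq T w - 2 * Re l" for w l
  have \<Phi>_ge: "- B \<le> \<Phi> w l" if "S w l" for w l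
  proof -
    have "(2 * cmod l)\<^sup>2 \<le> 4 * (B * L2_sq T w)" using bound[OF that] by (simp add: power_mult_distrib)
    also have "\<dots> \<le> (L2_sq T w + B)\<^sup>2"
      using zero_le_power2[of "L2_sq T w - B"] by (simp add: power2_eq_square algebra_simps)
    finally have "2 * cmod l \<le> L2_sq T w + B"
      by (rule power2_le_imp_le) (use B L2_sq_nonneg in auto)
    then show ?thesis using complex_Re_le_cmod[of l] by (simp add: \<Phi>_def)
  qed
  define V where "V = {\<Phi> w l |w l. S w l}"
  define m where "m = Inf V"
  have V: "V \<noteq> {}" "bdd_below V"
    using zero \<Phi>_ge by (auto simp: V_def intro!: bdd_belowI[of _ "- B"])
  have m: "m \<le> \<Phi> w l" if "S w l" for w l
    unfolding m_def using that by (intro cInf_lower V) (auto simp: V_def)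
  \<comment> \<open>The slack is chosen for \<open>L2_complete\<close>: with \<open>par\<close> it
    bounds the squared distance of consecutive terms by (1/8 + 1/2) * (1/4)^n.\<close>
  have "\<exists>w l. S w l \<and> \<Phi> w l < m + (1/4) ^ n / 4" for n
  proof -
    have "m < m + (1/4) ^ n / 4" by simp
    then obtain x where "x \<in> V" "x < m + (1/4) ^ n / 4"
      unfolding m_def using cInf_lessD[OF V(1)] by blast
    then show ?thesis unfolding V_def by blast
  qed
  then obtain w l where S: "\<And>n. S (w n) (l n)" and small: "\<And>n. \<Phi> (w n) (l n) < m + (1/4) ^ n / 4"
    by metis
  have w: "L2_fun T (w n)" for n using L2[OF S] .
  \<comment> \<open>The parallelogram identity: the midpoint of \<open>x\<close> and
    \<open>y\<close> again belongs to \<open>S\<close>, so its value of \<open>\<Phi>\<close> is at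
    least \<open>m\<close>. The half \<open>q\<close> of \<open>x\<close> is built from the zero
    element because \<open>comb\<close> scales only its second argument.\<close>
  have par: "L2_sq T (\<lambda>t. x t - y t) \<le> 2 * (\<Phi> x a - m) + 2 * (\<Phi> y b - m)" if x: "S x a" and y: "S y b" for x a y b
  proof -
    define p where "p = L2_inner T x y"
    have Lx: "L2_fun T x" and Ly: "L2_fun T y" using L2 x y by auto
    define q where "q t = 0 + 1/2 * x t" for t
    have q: "S q (cnj (1/2) * a)" using comb[OF zero x, of "1/2"] by (simp add: q_def[abs_def])
    have xy: "S (\<lambda>t. q t + 1/2 * y t) (cnj (1/2) * a + cnj (1/2) * b)"
      by (rule comb[OF q y])
    have Lq: "L2_sq T q = L2_sq T x / 4"
      by (simp add: q_def L2_sq_def norm_mult norm_divide power_divide)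
    have qy: "L2_inner T q y = p / 2"
      using L2_inner_scale_left[of T "1/2" x y] by (simp add: p_def q_def[abs_def])
    have "L2_sq T (\<lambda>t. q t + 1/2 * y t) = L2_sq T x / 4 + Re p / 2 + L2_sq T y / 4"
      unfolding L2_sq_add_scale[OF L2[OF q] Ly] Lq qy by (simp add: norm_divide power_divide)
    then have "m \<le> L2_sq T x / 4 + Re p / 2 + L2_sq T y / 4 - Re a - Re b"
      using m[OF xy] by (simp add: \<Phi>_def)
    moreover have "L2_sq T (\<lambda>t. x t - y t) = L2_sq T x - 2 * Re p + L2_sq T y"
      using L2_sq_add_scale[OF Lx Ly, of "- 1"] by (simp add: p_def)
    ultimately show ?thesis by (simp add: \<Phi>_def)
  qed
  have "L2_sq T (\<lambda>t. w (Suc n) t - w n t) \<le> (1/4) ^ n" for n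
  proof -
    have small': "\<Phi> (w n) (l n) - m \<le> (1/4) ^ n / 4" for n
      using small[of n] by linarith
    have "L2_sq T (\<lambda>t. w (Suc n) t - w n t) \<le> 2 * ((1/4) ^ Suc n / 4) + 2 * ((1/4) ^ n / 4)"
      by (rule order_trans[OF par[OF S S]], intro add_mono mult_left_mono small') auto
    also have "\<dots> \<le> (1/4) ^ n" by simp
    finally show ?thesis .
  qed
  from L2_complete[OF w this] obtain u where u: "L2_fun T u"
    and lim: "(\<lambda>n. L2_sq T (\<lambda>t. u t - w n t)) \<longlonglongrightarrow> 0" by blast
  have "L2_inner T u x = a" if x: "S x a" for x a
  proof -
    have Lx: "L2_fun T x" using L2[OF x] .
    define z where "z = L2_inner T u x - a"
    have conv: "(\<lambda>n. L2_inner T (w n) x) \<longlonglongrightarrow> L2_inner T u x"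
    proof -
      have "(\<lambda>n. (cmod (L2_inner T u x - L2_inner T (w n) x))\<^sup>2) \<longlonglongrightarrow> 0"
      proof (rule tendsto_sandwich[OF _ _ tendsto_const])
        show "\<forall>\<^sub>F n in sequentially. (cmod (L2_inner T u x - L2_inner T (w n) x))\<^sup>2
            \<le> L2_sq T (\<lambda>t. u t - w n t) * L2_sq T x"
          using L2_inner_abs_le[OF L2_fun_diff[OF u w] Lx] L2_inner_diff_left[OF u w Lx] by simp
        show "(\<lambda>n. L2_sq T (\<lambda>t. u t - w n t) * L2_sq T x) \<longlonglongrightarrow> 0"
          using tendsto_mult_left_zero[OF lim] .
      qed simp
      then have "(\<lambda>n. sqrt ((cmod (L2_inner T u x - L2_inner T (w n) x))\<^sup>2)) \<longlonglongrightarrow> sqrt 0"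
        by (rule tendsto_real_sqrt)
      then have "(\<lambda>n. L2_inner T u x - L2_inner T (w n) x) \<longlonglongrightarrow> 0"
        by (simp add: tendsto_norm_zero_iff)
      from tendsto_diff[OF tendsto_const[of "L2_inner T u x"] this] show ?thesis by simp
    qed
    \<comment> \<open>First variation at the limit: moving \<open>w n\<close> by \<open>c\<close>
      times \<open>x\<close> cannot push \<open>\<Phi>\<close> below \<open>m\<close>, and
      \<open>w n\<close> is within a vanishing slack of \<open>m\<close>.\<close>
    have var: "0 \<le> 2 * Re (cnj c * z) + (cmod c)\<^sup>2 * L2_sq T x" for c
    proof -
      have "- ((1/4) ^ n / 4) \<le> 2 * Re (cnj c * (L2_inner T (w n) x - a)) + (cmod c)\<^sup>2 * L2_sq T x" for n
        using m[OF comb[OF S[of n] x, of c]] small[of n] L2_sq_add_scale[OF w[of n] Lx, of c]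
        by (simp add: \<Phi>_def right_diff_distrib)
      moreover have "(\<lambda>n. - ((1/4) ^ n / 4) :: real) \<longlonglongrightarrow> 0" by real_asymp
      moreover have "(\<lambda>n. 2 * Re (cnj c * (L2_inner T (w n) x - a)) + (cmod c)\<^sup>2 * L2_sq T x)
          \<longlonglongrightarrow> 2 * Re (cnj c * z) + (cmod c)\<^sup>2 * L2_sq T x"
        unfolding z_def by (intro tendsto_intros conv)
      ultimately show ?thesis by (meson LIMSEQ_le)
    qed
    \<comment> \<open>With c = -r z the linear term is -2 r |z|^2, and this r keeps the quadratic
      term at most r |z|^2, so z must vanish. The added 1 covers the case
      \<open>L2_sq T x = 0\<close>.\<close>
    define r where "r = 1 / (L2_sq T x + 1)"
    have r: "r > 0" "r * L2_sq T x < 1"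
      using L2_sq_nonneg[of T x] by (auto simp: r_def)
    have "0 \<le> 2 * Re (cnj (- of_real r * z) * z) + (cmod (- of_real r * z))\<^sup>2 * L2_sq T x" by (rule var)
    also have "Re (cnj (- of_real r * z) * z) = - r * (cmod z)\<^sup>2"
      unfolding cmod_power2 by (simp add: power2_eq_square algebra_simps)
    also have "(cmod (- of_real r * z))\<^sup>2 * L2_sq T x = (r * L2_sq T x) * (r * (cmod z)\<^sup>2)"
      by (simp add: norm_mult power_mult_distrib power2_eq_square)
    also have "\<dots> \<le> 1 * (r * (cmod z)\<^sup>2)" using r by (intro mult_right_mono) auto
    finally have "r * (cmod z)\<^sup>2 \<le> 0" by simp
    then show ?thesis using r by (simp add: z_def mult_le_0_iff)
  qed
  then show ?thesis using u by blast
qed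

section \<open>Moment problems\<close>

lemma kernel_form_L2_inner:
  assumes "\<And>i. i \<in> F \<Longrightarrow> L2_fun T (f i)"
  shows "kernel_form (\<lambda>i j. L2_inner T (f i) (f j)) F a = L2_sq T (\<lambda>t. \<Sum>i\<in>F. cnj (a i) * f i t)"
proof -
  define w where "w t = (\<Sum>i\<in>F. cnj (a i) * f i t)" for t
  have f': "L2_fun T (\<lambda>t. cnj (a i) * f i t)" if "i \<in> F" for i
    using assms[OF that] by (rule L2_fun_scale)
  have w: "L2_fun T w" unfolding w_def[abs_def] by (rule L2_fun_sum) (rule f')
  have "complex_of_real (L2_sq T w) = L2_inner T w w" by (rule L2_inner_self[symmetric])
  also have "\<dots> = (\<Sum>i\<in>F. cnj (a i) * L2_inner T (f i) w)"
    using L2_inner_sum_left[of F T "\<lambda>i t. cnj (a i) * f i t" w, OF f' w]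
    by (simp add: w_def[abs_def] L2_inner_scale_left)
  also have "\<dots> = (\<Sum>i\<in>F. cnj (a i) * (\<Sum>j\<in>F. a j * L2_inner T (f i) (f j)))"
  proof (rule sum.cong[OF refl])
    fix i assume i: "i \<in> F"
    have "L2_inner T (f i) w = (\<Sum>j\<in>F. L2_inner T (f i) (\<lambda>t. cnj (a j) * f j t))"
      using L2_inner_sum_right[of F T "\<lambda>i t. cnj (a i) * f i t" "f i", OF f' assms[OF i]]
      by (simp add: w_def[abs_def])
    then show "cnj (a i) * L2_inner T (f i) w = cnj (a i) * (\<Sum>j\<in>F. a j * L2_inner T (f i) (f j))"
      by (simp add: L2_inner_scale_right)
  qed
  finally have "complex_of_real (L2_sq T w) = (\<Sum>i\<in>F. \<Sum>j\<in>F. cnj (a i) * a j * L2_inner T (f i) (f j))"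
    by (simp only: sum_distrib_left mult.assoc)
  then show ?thesis
    unfolding kernel_form_def w_def[symmetric] by (metis Re_complex_of_real)
qed

lemma cmod_sum_cnj_mult_sq_le:
  "(cmod (\<Sum>i\<in>F. cnj (a i) * c i))\<^sup>2 \<le> (\<Sum>i\<in>F. (cmod (a i))\<^sup>2) * (\<Sum>i\<in>F. (cmod (c i))\<^sup>2)"
proof -
  have "cmod (\<Sum>i\<in>F. cnj (a i) * c i) \<le> (\<Sum>i\<in>F. cmod (a i) * cmod (c i))"
    by (rule order_trans[OF norm_sum]) (simp add: norm_mult)
  then have "(cmod (\<Sum>i\<in>F. cnj (a i) * c i))\<^sup>2 \<le> (\<Sum>i\<in>F. cmod (a i) * cmod (c i))\<^sup>2"
    by (rule power_mono) simp
  also have "\<dots> \<le> (\<Sum>i\<in>F. (cmod (a i))\<^sup>2) * (\<Sum>i\<in>F. (cmod (c i))\<^sup>2)"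
    by (rule Cauchy_Schwarz_ineq_sum)
  finally show ?thesis .
qed

text \<open>The integral of f u is the inner product of u with the conjugate of f, so the moments
  prescribe an antilinear functional on the span of the conjugates. Cauchy-Schwarz and the lower
  bound give it the squared norm bound C/m, and its representing function solves the
  problem.\<close>

lemma moment_problem_solvable:
  assumes f: "\<And>j. j \<in> J \<Longrightarrow> L2_fun T (f j)" and m: "m > 0"
    and low: "\<And>F. finite F \<Longrightarrow> F \<subseteq> J \<Longrightarrow> form_lower_bound (\<lambda>i j. L2_inner T (f i) (f j)) F m"
    and C: "\<And>F. finite F \<Longrightarrow> F \<subseteq> J \<Longrightarrow> (\<Sum>i\<in>F. (cmod (c i))\<^sup>2) \<le> C"
  shows "\<exists>u. L2_fun T u \<and> (\<forall>j\<in>J. (LINT t|lebesgue_on {0..T}. f j t * u t) = c j)"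
proof -
  \<comment> \<open>A relation rather than a function of \<open>w\<close>, since the coefficients
    need not be read off from \<open>w\<close>; \<open>L2_riesz\<close> asks only for a bound on the
    graph.\<close>
  define S where "S w l \<longleftrightarrow> (\<exists>F a. finite F \<and> F \<subseteq> J \<and> w = (\<lambda>t. \<Sum>i\<in>F. a i * cnj (f i t))
    \<and> l = (\<Sum>i\<in>F. cnj (a i) * c i))" for w l
  have "\<exists>u. L2_fun T u \<and> (\<forall>w l. S w l \<longrightarrow> L2_inner T u w = l)"
  proof (rule L2_riesz)
    show "L2_fun T w" if "S w l" for w l
      using that f unfolding S_def by (force intro!: L2_fun_sum L2_fun_scale L2_fun_cnj)
    show "S (\<lambda>t. 0) 0" unfolding S_def by (intro exI[of _ "{}"]) simp
    show "C / m \<ge> 0" using C[of "{}"] m by simp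
  next
    fix w l assume "S w l"
    then obtain F a where F: "finite F" "F \<subseteq> J" and w: "w = (\<lambda>t. \<Sum>i\<in>F. a i * cnj (f i t))"
      and l: "l = (\<Sum>i\<in>F. cnj (a i) * c i)" by (auto simp: S_def)
    have "w t = cnj (\<Sum>i\<in>F. cnj (a i) * f i t)" for t by (simp add: w)
    then have "L2_sq T w = L2_sq T (\<lambda>t. \<Sum>i\<in>F. cnj (a i) * f i t)"
      unfolding L2_sq_def by (simp only: complex_mod_cnj)
    also have "\<dots> = kernel_form (\<lambda>i j. L2_inner T (f i) (f j)) F a"
      using F f by (intro kernel_form_L2_inner[symmetric]) auto
    finally have "m * (\<Sum>i\<in>F. (cmod (a i))\<^sup>2) \<le> L2_sq T w"
      using low[OF F] by (simp add: form_lower_bound_def)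
    then have a: "(\<Sum>i\<in>F. (cmod (a i))\<^sup>2) \<le> L2_sq T w / m" using m by (simp add: field_simps)
    have "(cmod l)\<^sup>2 \<le> (\<Sum>i\<in>F. (cmod (a i))\<^sup>2) * (\<Sum>i\<in>F. (cmod (c i))\<^sup>2)"
      unfolding l by (rule cmod_sum_cnj_mult_sq_le)
    also have "\<dots> \<le> (L2_sq T w / m) * C"
      using a C[OF F] m L2_sq_nonneg[of T w] by (intro mult_mono) (auto intro: sum_nonneg)
    finally show "(cmod l)\<^sup>2 \<le> C / m * L2_sq T w" by (simp add: mult.commute)
  next
    fix w l w' l' d assume "S w l" "S w' l'"
    then obtain F a F' a' where F: "finite F" "F \<subseteq> J" "w = (\<lambda>t. \<Sum>i\<in>F. a i * cnj (f i t))"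
        "l = (\<Sum>i\<in>F. cnj (a i) * c i)"
      and F': "finite F'" "F' \<subseteq> J" "w' = (\<lambda>t. \<Sum>i\<in>F'. a' i * cnj (f i t))"
        "l' = (\<Sum>i\<in>F'. cnj (a' i) * c i)" by (auto simp: S_def)
    define G where "G = F \<union> F'"
    define g where "g i = (if i \<in> F then a i else 0) + d * (if i \<in> F' then a' i else 0)" for i
    have ext: "(\<Sum>i\<in>G. (if i \<in> H then x i else 0) * y i) = (\<Sum>i\<in>H. x i * y i)"
      if "H \<subseteq> G" for H and x y :: "nat \<Rightarrow> complex"
      using F(1) F'(1) that by (intro sum.mono_neutral_cong_right) (auto simp: G_def)
    have "w t + d * w' t = (\<Sum>i\<in>G. g i * cnj (f i t))" for t
      using ext[of F a "\<lambda>i. cnj (f i t)"] ext[of F' a' "\<lambda>i. cnj (f i t)"]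
      by (simp add: F F' G_def g_def distrib_right sum.distrib mult.assoc sum_distrib_left[symmetric])
    moreover have "l + cnj d * l' = (\<Sum>i\<in>G. cnj (g i) * c i)"
      using ext[of F "\<lambda>i. cnj (a i)" c] ext[of F' "\<lambda>i. cnj (a' i)" c]
      by (simp add: F F' G_def g_def distrib_right sum.distrib mult.assoc sum_distrib_left[symmetric]
          if_distrib[of cnj] cong: if_cong)
    ultimately show "S (\<lambda>t. w t + d * w' t) (l + cnj d * l')"
      unfolding S_def using F F' by (intro exI[of _ G] exI[of _ g]) (auto simp: G_def)
  qed
  then obtain u where u: "L2_fun T u" and *: "\<And>w l. S w l \<Longrightarrow> L2_inner T u w = l" by blast
  have "(LINT t|lebesgue_on {0..T}. f j t * u t) = c j" if j: "j \<in> J" for j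
  proof -
    have "S (\<lambda>t. cnj (f j t)) (c j)"
      unfolding S_def using j by (intro exI[of _ "{j}"] exI[of _ "\<lambda>_. 1"]) simp
    from *[OF this] show ?thesis by (simp add: L2_inner_def mult.commute)
  qed
  with u show ?thesis by blast
qed

text \<open>
  Uniform boundedness replaces the closed graph theorem: the functionals \<open>(\<cdot>, \<Sum> a\<^sub>i g\<^sub>i)\<close> with
  \<open>\<parallel>\<Sum> cnj a\<^sub>i f\<^sub>i\<parallel> \<le> 1\<close> are pointwise bounded, by the norm of a solution of the moment problem.
\<close>

lemma moment_problem_lower_bound:
  fixes g h :: "nat \<Rightarrow> 'y::{complex_inner,banach}"
  assumes f: "\<And>j. j \<in> J \<Longrightarrow> L2_fun T (f j)"
    and M: "M > 0" "\<And>F c. finite F \<Longrightarrow> F \<subseteq> J \<Longrightarrow> (norm (\<Sum>i\<in>F. c i *\<^sub>C h i))\<^sup>2 \<le> M * (\<Sum>i\<in>F. (cmod (c i))\<^sup>2)"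
    and biorth: "\<And>m n. m \<in> J \<Longrightarrow> n \<in> J \<Longrightarrow> cinner (h m) (g n) = (if m = n then 1 else 0)"
    and solvable: "\<And>y. \<exists>u. L2_fun T u \<and> (\<forall>j\<in>J. (LINT t|lebesgue_on {0..T}. f j t * u t) = cinner y (g j))"
  shows "\<exists>m>0. \<forall>F. finite F \<and> F \<subseteq> J \<longrightarrow> form_lower_bound (\<lambda>i j. L2_inner T (f i) (f j)) F m"
proof -
  define q where "q F a = L2_sq T (\<lambda>t. \<Sum>i\<in>F. cnj (a i) * f i t)" for F a
  define v where "v F a = (\<Sum>i\<in>F. a i *\<^sub>C g i)" for F a
  define W where "W = {\<lambda>y. cinner y (v F a) |F a. finite F \<and> F \<subseteq> J \<and> q F a \<le> 1}"
  have "\<exists>B. \<forall>w\<in>W. \<forall>y. norm (w y) \<le> B * norm y"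
  proof (rule uniform_boundedness)
    show "bounded_linear w" if "w \<in> W" for w
      using that by (auto simp: W_def intro: bounded_linear_cinner_left)
    fix y
    obtain u where u: "L2_fun T u" and mom: "\<And>j. j \<in> J \<Longrightarrow> (LINT t|lebesgue_on {0..T}. f j t * u t) = cinner y (g j)"
      using solvable by blast
    have "norm (w y) \<le> sqrt (L2_sq T u)" if w: "w \<in> W" for w
    proof -
      from w obtain F a where F: "finite F" "F \<subseteq> J" "q F a \<le> 1" and w: "w = (\<lambda>y. cinner y (v F a))"
        by (auto simp: W_def)
      define G where "G t = (\<Sum>i\<in>F. cnj (a i) * f i t)" for t
      have f': "L2_fun T (\<lambda>t. cnj (a i) * f i t)" if "i \<in> F" for i
        using f F(2) that by (intro L2_fun_scale) auto
      have G: "L2_fun T G" unfolding G_def[abs_def] by (rule L2_fun_sum) (rule f')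
      have cu: "L2_fun T (\<lambda>t. cnj (u t))" using u by (rule L2_fun_cnj)
      have "L2_inner T G (\<lambda>t. cnj (u t)) = (\<Sum>i\<in>F. L2_inner T (\<lambda>t. cnj (a i) * f i t) (\<lambda>t. cnj (u t)))"
        unfolding G_def[abs_def] by (rule L2_inner_sum_left[OF f' cu])
      also have "\<dots> = (\<Sum>i\<in>F. cnj (a i) * cinner y (g i))"
        unfolding L2_inner_scale_left using mom F(2)
        by (intro sum.cong) (auto simp: L2_inner_def)
      also have "\<dots> = w y" by (simp add: w v_def cinner_sum_right cinner_scaleC_right)
      finally have "(cmod (w y))\<^sup>2 \<le> L2_sq T G * L2_sq T (\<lambda>t. cnj (u t))"
        using L2_inner_abs_le[OF G cu] by simp
      also have "\<dots> \<le> 1 * L2_sq T u"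
        using F(3) L2_sq_nonneg[of T u] by (intro mult_mono) (auto simp: q_def G_def[abs_def] L2_sq_def)
      finally show ?thesis by (intro real_le_rsqrt) simp
    qed
    then show "\<exists>B. \<forall>w\<in>W. norm (w y) \<le> B" by blast
  qed
  then obtain B where B: "\<And>w y. w \<in> W \<Longrightarrow> norm (w y) \<le> B * norm y" by blast
  define N where "N F a = (\<Sum>i\<in>F. (cmod (a i))\<^sup>2)" for F :: "nat set" and a :: "nat \<Rightarrow> complex"
  \<comment> \<open>The + 1 keeps \<open>K\<close> positive, so that 1/K can be the final lower
    bound.\<close>
  define K where "K = B\<^sup>2 * M + 1"
  have K: "K > 0" using M(1) by (simp add: K_def add_nonneg_pos)
  have unit: "N F a \<le> K" if F: "finite F" "F \<subseteq> J" "q F a \<le> 1" for F a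
  proof -
    \<comment> \<open>The test vector has coefficients \<open>a\<close> in the dual family
      \<open>h\<close>. Biorthogonality makes its pairing with \<open>v F a\<close> equal to N,
      while its squared norm is at most M N; hence N^2 \<le> B^2 M N.\<close>
    define y where "y = (\<Sum>i\<in>F. a i *\<^sub>C h i)"
    have N0: "N F a \<ge> 0" unfolding N_def by (intro sum_nonneg) auto
    have "cinner y (g i) = a i" if "i \<in> F" for i
    proof -
      have "cinner y (g i) = (\<Sum>k\<in>F. a k * (if k = i then 1 else 0))"
        unfolding y_def cinner_sum_left cinner_scaleC_left
      proof (rule sum.cong[OF refl])
        fix k assume "k \<in> F"
        then have "k \<in> J" "i \<in> J" using F(2) that by auto
        then show "a k * cinner (h k) (g i) = a k * (if k = i then 1 else 0)"
          by (simp only: biorth)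
      qed
      then show ?thesis using F(1) that by (simp add: if_distrib[of "\<lambda>x. _ * x"] cong: if_cong)
    qed
    then have "cinner y (v F a) = (\<Sum>i\<in>F. cnj (a i) * a i)"
      unfolding v_def cinner_sum_right cinner_scaleC_right by (intro sum.cong) auto
    also have "\<dots> = of_real (N F a)"
      by (simp add: N_def complex_norm_square mult.commute del: of_real_power)
    finally have "norm (cinner y (v F a)) = N F a" using N0 by simp
    moreover have "(\<lambda>y. cinner y (v F a)) \<in> W" using F by (auto simp: W_def)
    ultimately have "N F a \<le> B * norm y" using B by metis
    then have "(N F a)\<^sup>2 \<le> (B * norm y)\<^sup>2" using N0 by (intro power_mono)
    also have "\<dots> \<le> B\<^sup>2 * (M * N F a)"
      using M(2)[OF F(1,2), of a] by (simp add: power_mult_distrib y_def N_def mult_left_mono)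
    finally have "N F a * N F a \<le> N F a * (B\<^sup>2 * M)" by (simp add: power2_eq_square mult_ac)
    then have "N F a \<le> B\<^sup>2 * M"
      using N0 M(1) by (cases "N F a = 0") auto
    then show ?thesis by (simp add: K_def)
  qed
  have "N F a \<le> K * q F a" if F: "finite F" "F \<subseteq> J" for F a
  proof (rule field_le_epsilon)
    fix e :: real assume e: "e > 0"
    \<comment> \<open>Normalising by sqrt (\<open>q F a\<close>) would fail when this value is 0, so
      it is enlarged by e/K, which costs exactly e in the end.\<close>
    define p where "p = q F a + e / K"
    have q0: "q F a \<ge> 0" unfolding q_def by (rule L2_sq_nonneg)
    have p: "p > 0" using q0 e K by (simp add: p_def add_nonneg_pos)
    define r where "r = 1 / sqrt p"
    have r: "r\<^sup>2 = 1 / p" using p by (simp add: r_def power_divide)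
    have "q F (\<lambda>i. of_real r * a i) = r\<^sup>2 * q F a"
      unfolding q_def using L2_sq_scale[of T "of_real r" "\<lambda>t. \<Sum>i\<in>F. cnj (a i) * f i t"]
      by (simp add: sum_distrib_left mult.assoc)
    also have "\<dots> \<le> 1" using p e K by (simp add: r p_def)
    finally have "N F (\<lambda>i. of_real r * a i) \<le> K" by (rule unit[OF F])
    moreover have "N F (\<lambda>i. of_real r * a i) = r\<^sup>2 * N F a"
      by (simp add: N_def norm_mult power_mult_distrib sum_distrib_left)
    ultimately have "N F a \<le> K * p" using p by (simp add: r pos_divide_le_eq)
    also have "\<dots> = K * q F a + e" using K by (simp add: p_def distrib_left)
    finally show "N F a \<le> K * q F a + e" .
  qed
  moreover have "kernel_form (\<lambda>i j. L2_inner T (f i) (f j)) F a = q F a" if "F \<subseteq> J" for F a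
    unfolding q_def using f that by (intro kernel_form_L2_inner) auto
  ultimately show ?thesis
    using K by (intro exI[of _ "1 / K"]) (auto simp: form_lower_bound_def N_def pos_divide_le_eq mult.commute)
qed

section \<open>Riesz bases\<close>

lemma Riesz_basis_upper:
  assumes "Riesz_basis I f"
  obtains M where "M > 0" "\<And>F c. finite F \<Longrightarrow> F \<subseteq> I \<Longrightarrow>
    (norm (\<Sum>i\<in>F. c i *\<^sub>C f i))\<^sup>2 \<le> M * (\<Sum>i\<in>F. (cmod (c i))\<^sup>2)"
proof -
  from assms obtain m M where "0 < M" and M: "\<forall>F c. finite F \<and> F \<subseteq> I \<longrightarrow>
      m * (\<Sum>i\<in>F. (cmod (c i))\<^sup>2) \<le> (norm (\<Sum>i\<in>F. c i *\<^sub>C f i))\<^sup>2 \<and>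
      (norm (\<Sum>i\<in>F. c i *\<^sub>C f i))\<^sup>2 \<le> M * (\<Sum>i\<in>F. (cmod (c i))\<^sup>2)"
    unfolding Riesz_basis_def by (elim conjE exE) rule
  show thesis
    by (rule that[OF \<open>0 < M\<close>]) (rule conjunct2[OF M[rule_format]], rule conjI)
qed

text \<open>Duality with the upper Riesz bound: pairing x with y = \<Sum> (x, f_i) f_i gives the sum
  s of squares, and s \<le> |x| |y| together with |y|^2 \<le> M s yields s \<le> M |x|^2.\<close>

lemma Riesz_basis_Bessel:
  assumes "Riesz_basis I f"
  obtains M where "M > 0" "\<And>x F. finite F \<Longrightarrow> F \<subseteq> I \<Longrightarrow> (\<Sum>i\<in>F. (cmod (cinner x (f i)))\<^sup>2) \<le> M * (norm x)\<^sup>2"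
proof -
  obtain M where M: "M > 0" "\<And>F c. finite F \<Longrightarrow> F \<subseteq> I \<Longrightarrow>
      (norm (\<Sum>i\<in>F. c i *\<^sub>C f i))\<^sup>2 \<le> M * (\<Sum>i\<in>F. (cmod (c i))\<^sup>2)"
    by (rule Riesz_basis_upper[OF assms]) (rule that)
  have "(\<Sum>i\<in>F. (cmod (cinner x (f i)))\<^sup>2) \<le> M * (norm x)\<^sup>2" if F: "finite F" "F \<subseteq> I" for x F
  proof -
    define s where "s = (\<Sum>i\<in>F. (cmod (cinner x (f i)))\<^sup>2)"
    define y where "y = (\<Sum>i\<in>F. cinner x (f i) *\<^sub>C f i)"
    have "cinner x y = of_real s"
      unfolding y_def s_def
      by (simp add: cinner_sum_right cinner_scaleC_right complex_norm_square mult.commute del: of_real_power)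
    then have "cmod (cinner x y) = \<bar>s\<bar>" by (simp only: norm_of_real)
    then have "s \<le> norm x * norm y" using cmod_cinner_le[of x y] by simp
    moreover have s0: "s \<ge> 0" unfolding s_def by (intro sum_nonneg) auto
    ultimately have "s\<^sup>2 \<le> (norm x * norm y)\<^sup>2" by (intro power_mono)
    also have "\<dots> \<le> (norm x)\<^sup>2 * (M * s)"
      using M(2)[OF F, of "\<lambda>i. cinner x (f i)"]
      by (simp add: power_mult_distrib y_def s_def mult_left_mono)
    finally have "s * s \<le> s * (M * (norm x)\<^sup>2)" by (simp add: power2_eq_square mult_ac)
    then show ?thesis
      unfolding s_def[symmetric] using s0 M(1) by (cases "s = 0") auto
  qed
  with M(1) show ?thesis by (rule that)
qed

lemma orthogonal_dense_eq_0:
  assumes "closure (cspan B) = UNIV" "\<And>y. y \<in> B \<Longrightarrow> cinner x y = 0"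
  shows "x = 0"
proof -
  have "cinner x x = 0"
  proof (rule bounded_linear_eq_cspan[where f = "\<lambda>y. cinner y x" and g = "\<lambda>_. 0", OF _ _ assms(1)])
    show "cinner (c *\<^sub>C y) x = 0" if "y \<in> B" for c y
      using assms(2)[OF that] cinner_commute[of y x] by (simp add: cinner_scaleC_left)
  qed (auto intro: bounded_linear_cinner_left)
  then show ?thesis by (simp add: cinner_self)
qed

text \<open>Both sides are bounded and linear in \<open>x\<close> and agree on the vectors
  \<open>\<phi> i\<close> by biorthogonality, so density suffices and no adjoint semigroup is
  introduced.\<close>

lemma C0_semigroup_adjoint_eigenvector:
  fixes S :: "real \<Rightarrow> 'a \<Rightarrow> 'a::{complex_inner,banach}"
  assumes S: "C0_semigroup S" and t: "t \<ge> 0"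
    and dense: "closure (cspan (\<phi> ` I)) = UNIV"
    and ev: "\<And>i. i \<in> I \<Longrightarrow> S t (\<phi> i) = e i *\<^sub>C \<phi> i"
    and biorth: "\<And>m n. m \<in> I \<Longrightarrow> n \<in> I \<Longrightarrow> cinner (\<phi> m) (\<psi> n) = (if m = n then 1 else 0)"
    and j: "j \<in> I"
  shows "cinner (S t x) (\<psi> j) = e j * cinner x (\<psi> j)"
proof (rule bounded_linear_eq_cspan[where f = "\<lambda>x. cinner (S t x) (\<psi> j)", OF _ _ dense])
  show "bounded_linear (\<lambda>x. cinner (S t x) (\<psi> j))"
    by (rule bounded_linear_compose[OF bounded_linear_cinner_left C0_semigroup_bounded_linear[OF S t]])
  show "bounded_linear (\<lambda>x. e j * cinner x (\<psi> j))"
    by (rule bounded_linear_compose[OF bounded_linear_mult_right bounded_linear_cinner_left])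
  fix c x assume "x \<in> \<phi> ` I"
  then obtain i where "i \<in> I" "x = \<phi> i" by blast
  then show "cinner (S t (c *\<^sub>C x)) (\<psi> j) = e j * cinner (c *\<^sub>C x) (\<psi> j)"
    using biorth[OF _ j] ev[of i] by (simp add: C0_semigroup_scaleC[OF S t] cinner_scaleC_left)
qed

text \<open>Allows a bounded functional to be moved inside the Bochner integral of the mild
  solution. On a bounded interval \<open>u\<close> is integrable, and the orbit of \<open>b\<close>
  is continuous and bounded.\<close>

lemma integrable_semigroup_control:
  fixes S :: "real \<Rightarrow> 'a \<Rightarrow> 'a::separable_chilbert"
  assumes S: "C0_semigroup S" and u: "L2_fun T u"
  shows "integrable (lebesgue_on {0..T}) (\<lambda>\<tau>. S (T - \<tau>) (u \<tau> *\<^sub>C b))"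
proof -
  define M where "M = lebesgue_on {0..T}"
  have cont: "continuous_on {0..T} (\<lambda>\<tau>. S (T - \<tau>) b)"
    by (rule continuous_on_compose2[OF C0_semigroup_continuous_on[OF S]])
      (auto intro!: continuous_intros)
  have u_int: "integrable M u"
  proof -
    have "L2_fun T (\<lambda>_. 1)" by (intro L2_fun_continuous continuous_on_const)
    from L2_fun_integrable_mult[OF u this] show ?thesis by (simp add: M_def)
  qed
  have Sb: "(\<lambda>\<tau>. S (T - \<tau>) b) \<in> borel_measurable M"
    unfolding M_def using cont by (rule continuous_imp_measurable_on_sets_lebesgue) auto
  obtain B where B: "B \<ge> 0" "\<And>t x. t \<in> {0..T} \<Longrightarrow> norm (S t x) \<le> B * norm x"
    using C0_semigroup_bounded[OF S] by blast
  have "integrable M (\<lambda>\<tau>. u \<tau> *\<^sub>C S (T - \<tau>) b)"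
  proof (rule Bochner_Integration.integrable_bound)
    show "integrable M (\<lambda>\<tau>. (B * norm b) *\<^sub>R u \<tau>)" using u_int by simp
    show "(\<lambda>\<tau>. u \<tau> *\<^sub>C S (T - \<tau>) b) \<in> borel_measurable M"
      using u_int Sb by (intro borel_measurable_continuous_Pair[where H = scaleC]
        bounded_bilinear.continuous_on[OF bounded_bilinear_scaleC] continuous_intros) auto
    show "AE \<tau> in M. norm (u \<tau> *\<^sub>C S (T - \<tau>) b) \<le> norm ((B * norm b) *\<^sub>R u \<tau>)"
    proof (rule AE_I2)
      fix \<tau> assume "\<tau> \<in> space M"
      then have "norm (S (T - \<tau>) b) \<le> B * norm b" using B(2)[of "T - \<tau>" b] by (simp add: M_def)
      then have "cmod (u \<tau>) * norm (S (T - \<tau>) b) \<le> cmod (u \<tau>) * (B * norm b)"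
        by (rule mult_left_mono) simp
      then show "norm (u \<tau> *\<^sub>C S (T - \<tau>) b) \<le> norm ((B * norm b) *\<^sub>R u \<tau>)"
        using B(1) by (simp add: norm_scaleC mult_ac)
    qed
  qed
  also have "integrable M (\<lambda>\<tau>. u \<tau> *\<^sub>C S (T - \<tau>) b) \<longleftrightarrow> integrable M (\<lambda>\<tau>. S (T - \<tau>) (u \<tau> *\<^sub>C b))"
    by (rule Bochner_Integration.integrable_cong) (auto simp: M_def C0_semigroup_scaleC[OF S])
  finally show ?thesis by (simp add: M_def)
qed

section \<open>Partial null-controllability\<close>

theorem theorem1:
  fixes DY :: "'y::separable_chilbert set" and AY :: "'y \<Rightarrow> 'y"
    and DZ :: "'z::separable_chilbert set" and AZ :: "'z \<Rightarrow> 'z"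
    and AYZ :: "'z \<Rightarrow> 'y"
    and D :: "('y \<times> 'z) set" and A :: "'y \<times> 'z \<Rightarrow> 'y \<times> 'z"
    and SY :: "real \<Rightarrow> 'y \<Rightarrow> 'y" and SZ :: "real \<Rightarrow> 'z \<Rightarrow> 'z"
    and S :: "real \<Rightarrow> 'y \<times> 'z \<Rightarrow> 'y \<times> 'z"
    and b :: "'y \<times> 'z"
    and I IY IZ :: "nat set" and ev :: "nat \<Rightarrow> complex"
    and \<phi> \<psi> :: "nat \<Rightarrow> 'y \<times> 'z"
    and t1 :: real
  assumes t1: "t1 > 0"
    and gen_Y: "generates DY AY SY"
    and gen_Z: "generates DZ AZ SZ"
    and AYZ: "bounded_clinear AYZ"
    and D: "D = DY \<times> DZ"
    and A: "A = block_op AY AYZ AZ"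
    and gen_A: "generates D A S"
    \<comment> \<open>standing spectral assumptions\<close>
    and pure_point: "op_spectrum D A = point_spectrum D A"
    and discrete: "finite (op_spectrum D A) \<or> (\<forall>\<mu>. \<not> \<mu> islimpt op_spectrum D A)"
    and multiplicity: "\<forall>\<mu>\<in>point_spectrum D A. finite_multiplicity D A \<mu>"
    and gen_eigenvectors: "\<exists>(K :: nat set) e. Riesz_basis K e \<and> (\<forall>k\<in>K. gen_eigenvector D A (e k))"
    and simple_Y: "\<forall>\<mu>\<in>point_spectrum DY AY. simple_eigenvalue DY AY \<mu>"
    and simple_Z: "\<forall>\<mu>\<in>point_spectrum DZ AZ. simple_eigenvalue DZ AZ \<mu>"
    and spectrum_A: "op_spectrum D A = op_spectrum DY AY \<union> op_spectrum DZ AZ"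
    and disjoint: "op_spectrum DY AY \<inter> op_spectrum DZ AZ = {}"
    and enum: "bij_betw ev I (op_spectrum D A)"
    and IY: "IY = {i \<in> I. ev i \<in> op_spectrum DY AY}"
    and IZ: "IZ = {i \<in> I. ev i \<in> op_spectrum DZ AZ}"
    \<comment> \<open>eigenvectors of the operator and of its adjoint\<close>
    and phi_Y: "\<forall>j\<in>IY. fst (\<phi> j) \<in> DY \<and> AY (fst (\<phi> j)) = ev j *\<^sub>C fst (\<phi> j) \<and> snd (\<phi> j) = 0"
    and psi_Y: "\<forall>j\<in>IY.
          fst (\<psi> j) \<in> adj_dom DY AY \<and> adj DY AY (fst (\<psi> j)) = cnj (ev j) *\<^sub>C fst (\<psi> j) \<and>
          snd (\<psi> j) \<in> adj_dom DZ AZ \<and>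
          adj UNIV AYZ (fst (\<psi> j)) + adj DZ AZ (snd (\<psi> j)) = cnj (ev j) *\<^sub>C snd (\<psi> j)"
    and phi_Z: "\<forall>k\<in>IZ.
          snd (\<phi> k) \<in> DZ \<and> AZ (snd (\<phi> k)) = ev k *\<^sub>C snd (\<phi> k) \<and>
          fst (\<phi> k) \<in> DY \<and> AY (fst (\<phi> k)) + AYZ (snd (\<phi> k)) = ev k *\<^sub>C fst (\<phi> k)"
    and psi_Z: "\<forall>k\<in>IZ.
          fst (\<psi> k) = 0 \<and>
          snd (\<psi> k) \<in> adj_dom DZ AZ \<and> adj DZ AZ (snd (\<psi> k)) = cnj (ev k) *\<^sub>C snd (\<psi> k)"
    and Riesz_phi: "Riesz_basis I \<phi>"
    and Riesz_psi: "Riesz_basis I \<psi>"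
    and biorthogonal: "\<forall>m\<in>I. \<forall>n\<in>I. cinner (\<phi> m) (\<psi> n) = (if m = n then 1 else 0)"
    \<comment> \<open>the hypothesis on the series\<close>
    and series: "\<forall>z0. (\<lambda>j. (cmod (exp (- ev j * of_real t1)))\<^sup>2 *
                           (cmod (cinner (SZ t1 z0) (snd (\<psi> j))))\<^sup>2) summable_on IY"
  shows "partially_null_controllable S b t1 \<longleftrightarrow>
         strongly_minimal (L2_inner t1)
           (\<lambda>j t. exp (- ev j * of_real t) * b_fun SZ ev \<psi> b t1 j t) IY"
proof -

  \<comment> \<open>Evolution on the eigenvectors\<close>
  have S: "C0_semigroup S" and SZ: "C0_semigroup SZ"
    using gen_A gen_Z by (auto simp: generates_def)
  have I_cases: "i \<in> IY \<or> i \<in> IZ" if "i \<in> I" for i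
    using bij_betwE[OF enum] spectrum_A that by (auto simp: IY IZ)
  have IY_I: "IY \<subseteq> I" by (auto simp: IY)
  have dense_phi: "closure (cspan (\<phi> ` I)) = UNIV" and dense_psi: "closure (cspan (\<psi> ` I)) = UNIV"
    using Riesz_phi Riesz_psi by (auto simp: Riesz_basis_def)
  have AYZ0: "AYZ 0 = 0" using AYZ by (simp add: bounded_clinear_def linear_simps)
  \<comment> \<open>Generation characterises the domain by limits of difference quotients, which
    vanish identically at 0. This places the vectors \<open>\<phi> j\<close> with zero Z-part in
    \<open>D\<close>.\<close>
  have AZ0: "0 \<in> DZ \<and> AZ 0 = 0"
  proof -
    have "((\<lambda>h. (SZ h 0 - 0) /\<^sub>R h) \<longlongrightarrow> 0) (at_right 0)"
    proof (rule Lim_transform_eventually[OF tendsto_const])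
      show "\<forall>\<^sub>F h in at_right 0. 0 = (SZ h 0 - 0) /\<^sub>R h"
        unfolding eventually_at_right_field
        by (intro exI[of _ 1]) (auto simp: linear_simps(3)[OF C0_semigroup_bounded_linear[OF SZ]])
    qed
    then show ?thesis using gen_Z unfolding generates_def by blast
  qed
  have phi_D: "\<phi> i \<in> D \<and> A (\<phi> i) = ev i *\<^sub>C \<phi> i" if i: "i \<in> I" for i
    using I_cases[OF i]
  proof
    assume "i \<in> IY"
    then show ?thesis
      using phi_Y AZ0 AYZ0 complex_vector.scale_zero_right
      by (auto simp: D A block_op_def scaleC_prod_def split_beta mem_Times_iff intro!: prod_eqI)
  next
    assume "i \<in> IZ"
    then show ?thesis
      using phi_Z by (auto simp: D A block_op_def scaleC_prod_def split_beta mem_Times_iff intro!: prod_eqI)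
  qed
  have S_phi: "S t (\<phi> i) = exp (ev i * of_real t) *\<^sub>C \<phi> i" if "i \<in> I" "t \<ge> 0" for i t
    using generates_eigenvector[OF gen_A] phi_D[OF that(1)] that(2) by blast
  have S_psi: "cinner (S t x) (\<psi> j) = exp (ev j * of_real t) * cinner x (\<psi> j)"
    if "j \<in> I" "t \<ge> 0" for j t x
    using C0_semigroup_adjoint_eigenvector[OF S that(2) dense_phi S_phi[OF _ that(2)] _ that(1)] biorthogonal
    by blast
  \<comment> \<open>The triangular form of \<open>A\<close> makes the Z-component autonomous. On the
    basis this is clear: the Z-part of \<open>\<phi> i\<close> is 0 for \<open>i \<in> IY\<close>
    and an eigenvector of \<open>AZ\<close> for \<open>i \<in> IZ\<close>.\<close>
  have snd_S: "snd (S t x) = SZ t (snd x)" if t: "t \<ge> 0" for t x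
  proof (rule bounded_linear_eq_cspan[where f = "\<lambda>x. snd (S t x)", OF _ _ dense_phi])
    show "bounded_linear (\<lambda>x. snd (S t x))"
      by (rule bounded_linear_compose[OF bounded_linear_snd C0_semigroup_bounded_linear[OF S t]])
    show "bounded_linear (\<lambda>x. SZ t (snd x))"
      by (rule bounded_linear_compose[OF C0_semigroup_bounded_linear[OF SZ t] bounded_linear_snd])
    fix c x assume "x \<in> \<phi> ` I"
    then obtain i where i: "i \<in> I" "x = \<phi> i" by blast
    have "SZ t (snd (\<phi> i)) = exp (ev i * of_real t) *\<^sub>C snd (\<phi> i)"
      using I_cases[OF i(1)]
    proof
      assume "i \<in> IY"
      then show ?thesis
        using phi_Y complex_vector.scale_zero_right
        by (simp add: linear_simps(3)[OF C0_semigroup_bounded_linear[OF SZ t]])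
    next
      assume "i \<in> IZ"
      then show ?thesis using phi_Z generates_eigenvector[OF gen_Z _ _ t] by blast
    qed
    then have "snd (S t x) = SZ t (snd x)"
      by (simp only: i(2) S_phi[OF i(1) t] snd_scaleC)
    then show "snd (S t (c *\<^sub>C x)) = SZ t (snd (c *\<^sub>C x))"
      by (simp only: C0_semigroup_scaleC[OF S t] C0_semigroup_scaleC[OF SZ t] snd_scaleC)
  qed

  \<comment> \<open>Reduction of the steering condition to a moment problem\<close>
  define f where "f j t = exp (- ev j * of_real t) * b_fun SZ ev \<psi> b t1 j t" for j t
  have f_eq: "f j t = exp (- ev j * of_real t) * cinner b (\<psi> j)
      - exp (- ev j * of_real t1) * cinner (SZ (t1 - t) (snd b)) (snd (\<psi> j))" for j t
  proof -
    have "exp (- ev j * of_real t) * exp (ev j * of_real t) = 1"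
      by (simp add: exp_add[symmetric])
    then show ?thesis
      unfolding f_def b_fun_def by (simp add: right_diff_distrib mult.assoc[symmetric])
  qed
  have f_L2: "L2_fun t1 (f j)" for j
  proof (rule L2_fun_continuous)
    have "continuous_on {0..t1} (\<lambda>t. SZ (t1 - t) (snd b))"
      by (rule continuous_on_compose2[OF C0_semigroup_continuous_on[OF SZ]])
        (auto intro!: continuous_intros)
    then have "continuous_on {0..t1} (\<lambda>t. cinner (SZ (t1 - t) (snd b)) (snd (\<psi> j)))"
      by (rule bounded_linear.continuous_on[OF bounded_linear_cinner_left])
    then show "continuous_on {0..t1} (f j)"
      unfolding f_eq[abs_def] by (intro continuous_intros)
  qed

  define c0 where "c0 x0 j = cinner x0 (\<psi> j) - exp (- ev j * of_real t1) * cinner (SZ t1 (snd x0)) (snd (\<psi> j))" for x0 j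
  have key: "exp (- ev j * of_real t1) * cinner (fst (mild_solution S b x0 u t1)) (fst (\<psi> j))
      = c0 x0 j + (LINT t|lebesgue_on {0..t1}. f j t * u t)"
    if u: "L2_fun t1 u" and j: "j \<in> IY" for u x0 j
  proof -
    define E where "E = exp (- ev j * of_real t1)"
    define l where "l x = E * cinner (fst x) (fst (\<psi> j))" for x :: "'y \<times> 'z"
    have bl: "bounded_linear l"
      unfolding l_def[abs_def]
      by (rule bounded_linear_compose[OF bounded_linear_mult_right
            bounded_linear_compose[OF bounded_linear_cinner_left bounded_linear_fst]])
    \<comment> \<open>The Y-pairing is the full pairing with \<open>\<psi> j\<close> minus the
      Z-pairing; the former evolves by a scalar exponential, the latter by
      \<open>SZ\<close>.\<close>
    have l_S: "l (S t x) = exp (ev j * of_real (t - t1)) * cinner x (\<psi> j) - E * cinner (SZ t (snd x)) (snd (\<psi> j))"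
      if t: "t \<ge> 0" for t x
    proof -
      have "l (S t x) = E * (cinner (S t x) (\<psi> j) - cinner (snd (S t x)) (snd (\<psi> j)))"
        by (simp add: l_def cinner_prod_def)
      also have "cinner (S t x) (\<psi> j) = exp (ev j * of_real t) * cinner x (\<psi> j)"
        using S_psi[OF _ t] j IY_I by blast
      also have "E * (exp (ev j * of_real t) * cinner x (\<psi> j) - cinner (snd (S t x)) (snd (\<psi> j)))
          = (E * exp (ev j * of_real t)) * cinner x (\<psi> j) - E * cinner (SZ t (snd x)) (snd (\<psi> j))"
        by (simp add: snd_S[OF t] right_diff_distrib mult.assoc)
      also have "E * exp (ev j * of_real t) = exp (ev j * of_real (t - t1))"
        unfolding E_def exp_add[symmetric] by (simp add: right_diff_distrib)
      finally show ?thesis .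
    qed
    have "l (mild_solution S b x0 u t1) = l (S t1 x0) + l (LINT \<tau>|lebesgue_on {0..t1}. S (t1 - \<tau>) (u \<tau> *\<^sub>C b))"
      unfolding mild_solution_def using bl by (simp add: linear_simps)
    also have "l (S t1 x0) = c0 x0 j"
      using l_S[of t1 x0] t1 by (simp add: c0_def E_def)
    also have "l (LINT \<tau>|lebesgue_on {0..t1}. S (t1 - \<tau>) (u \<tau> *\<^sub>C b))
        = (LINT \<tau>|lebesgue_on {0..t1}. l (S (t1 - \<tau>) (u \<tau> *\<^sub>C b)))"
      by (rule integral_bounded_linear[OF bl integrable_semigroup_control[OF S u], symmetric])
    also have "\<dots> = (LINT \<tau>|lebesgue_on {0..t1}. f j \<tau> * u \<tau>)"
    proof (rule Bochner_Integration.integral_cong[OF refl])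
      fix \<tau> assume "\<tau> \<in> space (lebesgue_on {0..t1})"
      then have \<tau>: "t1 - \<tau> \<ge> 0" by simp
      have "l (S (t1 - \<tau>) (u \<tau> *\<^sub>C b)) = u \<tau> * (exp (ev j * of_real (t1 - \<tau> - t1)) * cinner b (\<psi> j)
          - E * cinner (SZ (t1 - \<tau>) (snd b)) (snd (\<psi> j)))"
        unfolding l_S[OF \<tau>]
        by (simp add: scaleC_prod_def C0_semigroup_scaleC[OF SZ \<tau>] cinner_prod_def cinner_scaleC_left algebra_simps)
      then show "l (S (t1 - \<tau>) (u \<tau> *\<^sub>C b)) = f j \<tau> * u \<tau>"
        by (simp add: f_eq E_def mult.commute)
    qed
    finally show ?thesis by (simp add: l_def E_def)
  qed
  have steer: "proj_Y (mild_solution S b x0 u t1) = 0 \<longleftrightarrow>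
      (\<forall>j\<in>IY. (LINT t|lebesgue_on {0..t1}. f j t * u t) = - c0 x0 j)"
    if u: "L2_fun t1 u" for u x0
  proof -
    define y where "y = fst (mild_solution S b x0 u t1)"
    have "proj_Y (mild_solution S b x0 u t1) = 0 \<longleftrightarrow> y = 0"
      by (auto simp: proj_Y_def y_def split_beta prod_eq_iff)
    \<comment> \<open>For indices in \<open>IZ\<close> the Y-part of \<open>\<psi> i\<close> is 0,
      so the conditions over \<open>IY\<close> already make \<open>(y, 0)\<close> orthogonal to the
      whole dense family.\<close>
    also have "\<dots> \<longleftrightarrow> (\<forall>j\<in>IY. cinner y (fst (\<psi> j)) = 0)"
    proof
      assume "\<forall>j\<in>IY. cinner y (fst (\<psi> j)) = 0"
      then have y: "cinner y (fst (\<psi> i)) = 0" if "i \<in> I" for i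
        using I_cases[OF that] psi_Z by (elim disjE) simp_all
      have "(y, 0 :: 'z) = 0"
        by (rule orthogonal_dense_eq_0[OF dense_psi]) (auto simp: cinner_prod_def y)
      then show "y = 0" by (simp add: prod_eq_iff)
    qed simp
    also have "\<dots> \<longleftrightarrow> (\<forall>j\<in>IY. c0 x0 j + (LINT t|lebesgue_on {0..t1}. f j t * u t) = 0)"
    proof (rule ball_cong[OF refl])
      fix j assume "j \<in> IY"
      from key[OF u this, of x0, folded y_def]
      show "cinner y (fst (\<psi> j)) = 0 \<longleftrightarrow> c0 x0 j + (LINT t|lebesgue_on {0..t1}. f j t * u t) = 0"
        by (metis exp_not_eq_zero mult_eq_0_iff)
    qed
    finally show ?thesis
      unfolding eq_neg_iff_add_eq_0 by (simp only: add.commute)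
  qed

  \<comment> \<open>Controllability and the lower bound\<close>
  have minimal_iff: "strongly_minimal (L2_inner t1) f IY \<longleftrightarrow>
      (\<exists>m>0. \<forall>F. finite F \<and> F \<subseteq> IY \<longrightarrow> form_lower_bound (\<lambda>i j. L2_inner t1 (f i) (f j)) F m)"
  proof (rule strongly_minimal_iff)
    show "L2_inner t1 y x = cnj (L2_inner t1 x y)" for x y by (rule L2_inner_commute)
    show "form_lower_bound (\<lambda>i j. L2_inner t1 (f i) (f j)) F 0" for F
      by (simp add: form_lower_bound_def kernel_form_L2_inner f_L2 L2_sq_nonneg)
  qed
  have "partially_null_controllable S b t1 \<longleftrightarrow> strongly_minimal (L2_inner t1) f IY"
    unfolding minimal_iff
  proof
    assume ctrl: "partially_null_controllable S b t1"
    obtain M where M: "M > 0" "\<And>F c. finite F \<Longrightarrow> F \<subseteq> I \<Longrightarrow>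
        (norm (\<Sum>i\<in>F. c i *\<^sub>C \<phi> i))\<^sup>2 \<le> M * (\<Sum>i\<in>F. (cmod (c i))\<^sup>2)"
      by (rule Riesz_basis_upper[OF Riesz_phi]) (rule that)
    show "\<exists>m>0. \<forall>F. finite F \<and> F \<subseteq> IY \<longrightarrow> form_lower_bound (\<lambda>i j. L2_inner t1 (f i) (f j)) F m"
    \<comment> \<open>Since the Z-part of \<open>\<phi> j\<close> is 0 for
      \<open>j \<in> IY\<close>, the Y-parts of the two families are biorthogonal in Y itself, and
      projecting to Y preserves the upper Riesz bound.\<close>
    proof (rule moment_problem_lower_bound[where h = "\<lambda>j. fst (\<phi> j)" and g = "\<lambda>j. fst (\<psi> j)", OF f_L2 M(1)])
      fix F c assume F: "finite F" "F \<subseteq> IY"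
      have "norm (\<Sum>i\<in>F. c i *\<^sub>C fst (\<phi> i)) = norm (fst (\<Sum>i\<in>F. c i *\<^sub>C \<phi> i))"
        by (simp only: fst_sum fst_scaleC)
      also have "\<dots> \<le> norm (\<Sum>i\<in>F. c i *\<^sub>C \<phi> i)" by (metis norm_fst_le prod.collapse)
      finally have "(norm (\<Sum>i\<in>F. c i *\<^sub>C fst (\<phi> i)))\<^sup>2 \<le> (norm (\<Sum>i\<in>F. c i *\<^sub>C \<phi> i))\<^sup>2"
        by (rule power_mono) simp
      also have "\<dots> \<le> M * (\<Sum>i\<in>F. (cmod (c i))\<^sup>2)" using F IY_I by (intro M(2)) auto
      finally show "(norm (\<Sum>i\<in>F. c i *\<^sub>C fst (\<phi> i)))\<^sup>2 \<le> M * (\<Sum>i\<in>F. (cmod (c i))\<^sup>2)" .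
    next
      fix m n assume mn: "m \<in> IY" "n \<in> IY"
      have "cinner (\<phi> m) (\<psi> n) = cinner (fst (\<phi> m)) (fst (\<psi> n))"
        using phi_Y mn by (simp add: cinner_prod_def)
      then show "cinner (fst (\<phi> m)) (fst (\<psi> n)) = (if m = n then 1 else 0)"
        using biorthogonal mn IY_I by (metis subsetD)
    next
      fix y
      \<comment> \<open>The zero Z-part removes the \<open>SZ\<close> term from \<open>c0\<close>,
        and the sign turns the moments \<open>- c0\<close> into the pairings with
        \<open>y\<close>.\<close>
      obtain u where u: "L2_fun t1 u" "proj_Y (mild_solution S b (- y, 0) u t1) = 0"
        using ctrl unfolding partially_null_controllable_def by blast
      have "- c0 (- y, 0) j = cinner y (fst (\<psi> j))" for j
      proof -
        have "SZ t1 0 = 0" using C0_semigroup_bounded_linear[OF SZ, of t1] t1 by (simp add: linear_simps)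
        moreover have "cinner (- y) (fst (\<psi> j)) = - cinner y (fst (\<psi> j))"
          using cinner_add_left[of y "- y" "fst (\<psi> j)"] by (simp add: eq_neg_iff_add_eq_0 add.commute)
        ultimately show ?thesis by (simp add: c0_def cinner_prod_def)
      qed
      with u steer[OF u(1)] show "\<exists>u. L2_fun t1 u \<and>
          (\<forall>j\<in>IY. (LINT t|lebesgue_on {0..t1}. f j t * u t) = cinner y (fst (\<psi> j)))"
        by auto
    qed
  next
    assume "\<exists>m>0. \<forall>F. finite F \<and> F \<subseteq> IY \<longrightarrow> form_lower_bound (\<lambda>i j. L2_inner t1 (f i) (f j)) F m"
    then obtain m where m: "m > 0"
      "\<And>F. finite F \<Longrightarrow> F \<subseteq> IY \<Longrightarrow> form_lower_bound (\<lambda>i j. L2_inner t1 (f i) (f j)) F m" by blast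
    obtain M where M: "M > 0" "\<And>x F. finite F \<Longrightarrow> F \<subseteq> I \<Longrightarrow>
        (\<Sum>i\<in>F. (cmod (cinner x (\<psi> i)))\<^sup>2) \<le> M * (norm x)\<^sup>2"
      by (rule Riesz_basis_Bessel[OF Riesz_psi]) (rule that)
    show "partially_null_controllable S b t1"
      unfolding partially_null_controllable_def
    proof
      fix x0 :: "'y \<times> 'z"
      define s where "s j = (cmod (exp (- ev j * of_real t1)))\<^sup>2 * (cmod (cinner (SZ t1 (snd x0)) (snd (\<psi> j))))\<^sup>2" for j
      have s: "s summable_on IY" unfolding s_def[abs_def] using series by blast
      have "\<exists>u. L2_fun t1 u \<and> (\<forall>j\<in>IY. (LINT t|lebesgue_on {0..t1}. f j t * u t) = - c0 x0 j)"
      proof (rule moment_problem_solvable[OF f_L2 m])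
        fix F assume F: "finite F" "F \<subseteq> IY"
        \<comment> \<open>Splitting the square separates the part bounded by Bessel's inequality for
          \<open>\<psi>\<close> from the part bounded by the series hypothesis; both bounds are
          independent of \<open>F\<close>.\<close>
        have "(\<Sum>i\<in>F. (cmod (- c0 x0 i))\<^sup>2) \<le> (\<Sum>i\<in>F. 2 * (cmod (cinner x0 (\<psi> i)))\<^sup>2 + 2 * s i)"
        proof (rule sum_mono)
          fix i
          show "(cmod (- c0 x0 i))\<^sup>2 \<le> 2 * (cmod (cinner x0 (\<psi> i)))\<^sup>2 + 2 * s i"
            using cmod_add_sq_le[of "cinner x0 (\<psi> i)" "- (exp (- ev i * of_real t1) * cinner (SZ t1 (snd x0)) (snd (\<psi> i)))"]
            by (simp only: c0_def s_def norm_minus_cancel norm_mult power_mult_distrib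
                diff_conv_add_uminus)
        qed
        also have "\<dots> = 2 * (\<Sum>i\<in>F. (cmod (cinner x0 (\<psi> i)))\<^sup>2) + 2 * sum s F"
          by (simp add: sum.distrib sum_distrib_left)
        also have "\<dots> \<le> 2 * (M * (norm x0)\<^sup>2) + 2 * infsum s IY"
        proof (intro add_mono mult_left_mono)
          show "(\<Sum>i\<in>F. (cmod (cinner x0 (\<psi> i)))\<^sup>2) \<le> M * (norm x0)\<^sup>2"
            using F IY_I by (intro M(2)) auto
          show "sum s F \<le> infsum s IY"
            using F s by (intro finite_sum_le_infsum) (auto simp: s_def)
        qed auto
        finally show "(\<Sum>i\<in>F. (cmod (- c0 x0 i))\<^sup>2) \<le> 2 * (M * (norm x0)\<^sup>2) + 2 * infsum s IY" .
      qed
      then show "\<exists>u. L2_fun t1 u \<and> proj_Y (mild_solution S b x0 u t1) = 0"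
        using steer by blast
    qed
  qed
  then show ?thesis by (simp only: f_def[abs_def])
qed

end
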